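(* Let $K/F$ be a computable field extension for which the degree map $\deg_F:K\to\mathbb{N}$ is computable, and let $C\subseteq\omega$ be a cohesive set. Assume further that $\{\deg_F(\alpha)\mid\alpha\in K\}$ is unbounded. Then $\prod_C K/\prod_C F$ is transcendental with infinite transcendence degree.
   Context: For $A,B\subseteq\omega$, $A\subseteq^* B$ means $A\setminus B$ is finite. A set $C\subseteq\omega$ is cohesive if it is infinite and for every c.e. set $W$ either $C\subseteq^*W$ or $C\subseteq^*\overline{W}$. A computable structure has computable domain $\subseteq\omega$ and computable atomic diagram. For a computable structure $\mathcal A$ and cohesive $C$, the cohesive power $\prod_C\mathcal A$ has as domain the classes $[\varphi]$ of partial computable functions $\varphi$ from $\omega$ to $\mathcal{A}$ with $C\subseteq^*\mathrm{dom}(\varphi)$, where $[\varphi]=[\psi]$ iff $C\subseteq^*\{i:\varphi(i){\downarrow}=\psi(i){\downarrow}\}$; functions and constants are interpreted pointwise. A computable field extension $K/F$ is a triple $(K,F,\Psi)$ with $K,F$ computable fields and $\Psi:F\to K$ a computable ring homomorphism; $F$ is identified with its image. $\prod_CF$ is regarded as a subfield of $\prod_CK$ via $[\alpha]\mapsto[\Psi\circ\alpha]$. For $\alpha\in K$ algebraic over $F$, $\deg_F(\alpha)=[F(\alpha):F]$ is the degree of its minimal polynomial; that the degree map is a function $K\to\mathbb{N}$ includes that every element of $K$ is algebraic over $F$. *)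

theory Defs
  imports "HOL-Algebra.Algebra" "HOL-Library.Nat_Bijection"
begin

section \<open>Partial computable functions\<close>

datatype recf =
    Zero
  | Succ
  | Proj nat
  | Comp recf "recf list"
  | PrimRec recf recf
  | Mu recf

text \<open>
  Kleene's partial recursive functions; \<^const>\<open>None\<close> means divergence. Arities are not tracked:
  a scheme applied to a list that is too short diverges, and superfluous arguments are ignored by
  the basic functions. This does not affect which partial functions of a fixed arity are definable.
\<close>

fun recf_eval :: "recf \<Rightarrow> nat list \<Rightarrow> nat option" where
  "recf_eval Zero xs = Some 0"
| "recf_eval Succ xs = (case xs of [] \<Rightarrow> None | x # _ \<Rightarrow> Some (Suc x))"
| "recf_eval (Proj i) xs = (if i < length xs then Some (xs ! i) else None)"
| "recf_eval (Comp f gs) xs =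
     (case those (map (\<lambda>g. recf_eval g xs) gs) of None \<Rightarrow> None | Some ys \<Rightarrow> recf_eval f ys)"
| "recf_eval (PrimRec f g) xs =
     (case xs of
        [] \<Rightarrow> None
      | n # ys \<Rightarrow>
          rec_nat (recf_eval f ys)
            (\<lambda>k r. case r of None \<Rightarrow> None | Some v \<Rightarrow> recf_eval g (k # v # ys)) n)"
| "recf_eval (Mu f) xs =
     (let is_min = (\<lambda>z. recf_eval f (z # xs) = Some 0 \<and>
                        (\<forall>y<z. \<exists>v. recf_eval f (y # xs) = Some (Suc v)))
      in if \<exists>z. is_min z then Some (LEAST z. is_min z) else None)"

definition partial_computable :: "(nat \<rightharpoonup> nat) \<Rightarrow> bool" where
  "partial_computable \<phi> \<longleftrightarrow> (\<exists>p. \<forall>x. recf_eval p [x] = \<phi> x)"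

definition computable_set :: "nat set \<Rightarrow> bool" where
  "computable_set A \<longleftrightarrow> partial_computable (\<lambda>x. Some (if x \<in> A then 1 else 0))"

definition computable_on :: "nat set \<Rightarrow> (nat \<Rightarrow> nat) \<Rightarrow> bool" where
  "computable_on A f \<longleftrightarrow> partial_computable (\<lambda>x. if x \<in> A then Some (f x) else None)"

definition ce_set :: "nat set \<Rightarrow> bool" where
  "ce_set W \<longleftrightarrow> (\<exists>\<phi>. partial_computable \<phi> \<and> W = dom \<phi>)"


section \<open>Cohesive sets\<close>

definition almost_subset :: "nat set \<Rightarrow> nat set \<Rightarrow> bool"  (infix \<open>\<subseteq>\<^sup>*\<close> 50) where
  "A \<subseteq>\<^sup>* B \<longleftrightarrow> finite (A - B)"

definition cohesive :: "nat set \<Rightarrow> bool" where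
  "cohesive C \<longleftrightarrow> infinite C \<and> (\<forall>W. ce_set W \<longrightarrow> C \<subseteq>\<^sup>* W \<or> C \<subseteq>\<^sup>* - W)"


section \<open>Computable fields and computable extensions\<close>

text \<open>
  Closed terms of the language \<open>{0, 1, +, \<cdot>}\<close> expanded by a constant for each element of the domain.
  Equality is the only relation symbol, so the atomic sentences are the equations between such terms.
\<close>

datatype 'a ring_term =
    TConst 'a
  | TZero
  | TOne
  | TAdd "'a ring_term" "'a ring_term"
  | TMult "'a ring_term" "'a ring_term"

primrec term_value :: "'a ring \<Rightarrow> 'a ring_term \<Rightarrow> 'a" where
  "term_value R (TConst a) = a"
| "term_value R TZero = \<zero>\<^bsub>R\<^esub>"
| "term_value R TOne = \<one>\<^bsub>R\<^esub>"
| "term_value R (TAdd s t) = term_value R s \<oplus>\<^bsub>R\<^esub> term_value R t"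
| "term_value R (TMult s t) = term_value R s \<otimes>\<^bsub>R\<^esub> term_value R t"

primrec term_code :: "nat ring_term \<Rightarrow> nat" where
  "term_code (TConst a) = prod_encode (0, a)"
| "term_code TZero = prod_encode (1, 0)"
| "term_code TOne = prod_encode (2, 0)"
| "term_code (TAdd s t) = prod_encode (3, prod_encode (term_code s, term_code t))"
| "term_code (TMult s t) = prod_encode (4, prod_encode (term_code s, term_code t))"

text \<open>
  The codes of the true atomic sentences (tag 1) and of the true negated atomic sentences (tag 0).
\<close>

definition atomic_diagram :: "nat ring \<Rightarrow> nat set" where
  "atomic_diagram R =
     {prod_encode (if term_value R s = term_value R t then 1 else 0,
                   prod_encode (term_code s, term_code t)) | s t.
        set_ring_term s \<subseteq> carrier R \<and> set_ring_term t \<subseteq> carrier R}"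

definition computable_field :: "nat ring \<Rightarrow> bool" where
  "computable_field K \<longleftrightarrow>
     field K \<and> computable_set (carrier K) \<and> computable_set (atomic_diagram K)"

definition computable_field_extension :: "nat ring \<Rightarrow> nat ring \<Rightarrow> (nat \<Rightarrow> nat) \<Rightarrow> bool" where
  "computable_field_extension K F \<Psi> \<longleftrightarrow>
     computable_field K \<and> computable_field F \<and>
     \<Psi> \<in> ring_hom F K \<and> computable_on (carrier F) \<Psi>"


section \<open>Field extensions\<close>

text \<open>
  An extension \<open>L/k\<close> is given by a ring \<open>L\<close> and the carrier \<open>k\<close> of a subfield of \<open>L\<close>.
\<close>

definition algebraic_extension :: "'a ring \<Rightarrow> 'a set \<Rightarrow> bool" where
  "algebraic_extension L k \<longleftrightarrow> (\<forall>x\<in>carrier L. (ring.algebraic L over k) x)"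

abbreviation transcendental_extension :: "'a ring \<Rightarrow> 'a set \<Rightarrow> bool" where
  "transcendental_extension L k \<equiv> \<not> algebraic_extension L k"

text \<open>
  The degree of the minimal polynomial of \<open>x\<close> over \<open>k\<close>; meaningful only for \<open>x\<close> algebraic over \<open>k\<close>.
\<close>

definition element_degree :: "'a ring \<Rightarrow> 'a set \<Rightarrow> 'a \<Rightarrow> nat" where
  "element_degree L k x = degree (ring.Irr L k x)"

text \<open>
  A polynomial in variables indexed by \<open>B\<close> is a map from monomials (multisets over \<open>B\<close>) to
  coefficients, as in \<^theory>\<open>HOL-Algebra.Indexed_Polynomials\<close>. Here the index set consists of ring
  elements, and each variable is evaluated at its own index.
\<close>

definition eval_at_indices :: "'a ring \<Rightarrow> ('a multiset \<Rightarrow> 'a) \<Rightarrow> 'a" where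
  "eval_at_indices L P =
     (\<Oplus>\<^bsub>L\<^esub>m\<in>{m. P m \<noteq> \<zero>\<^bsub>L\<^esub>}.
        P m \<otimes>\<^bsub>L\<^esub> (\<Otimes>\<^bsub>L\<^esub>x\<in>set_mset m. x [^]\<^bsub>L\<^esub> count m x))"

definition algebraically_independent :: "'a ring \<Rightarrow> 'a set \<Rightarrow> 'a set \<Rightarrow> bool" where
  "algebraically_independent L k B \<longleftrightarrow>
     B \<subseteq> carrier L \<and>
     (\<forall>P\<in>ring.indexed_pset L B k.
        eval_at_indices L P = \<zero>\<^bsub>L\<^esub> \<longrightarrow> P = ring.indexed_const L \<zero>\<^bsub>L\<^esub>)"

definition transcendence_basis :: "'a ring \<Rightarrow> 'a set \<Rightarrow> 'a set \<Rightarrow> bool" where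
  "transcendence_basis L k B \<longleftrightarrow>
     algebraically_independent L k B \<and>
     (\<forall>B'. algebraically_independent L k B' \<and> B \<subseteq> B' \<longrightarrow> B' = B)"

text \<open>
  The transcendence degree is the common cardinality of all transcendence bases, so it is infinite
  iff some basis is infinite.
\<close>

definition infinite_transcendence_degree :: "'a ring \<Rightarrow> 'a set \<Rightarrow> bool" where
  "infinite_transcendence_degree L k \<longleftrightarrow> (\<exists>B. transcendence_basis L k B \<and> infinite B)"


section \<open>Cohesive powers\<close>

definition cohesive_power_maps :: "nat set \<Rightarrow> nat ring \<Rightarrow> (nat \<rightharpoonup> nat) set" where
  "cohesive_power_maps C A =
     {\<phi>. partial_computable \<phi> \<and> ran \<phi> \<subseteq> carrier A \<and> C \<subseteq>\<^sup>* dom \<phi>}"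

definition cohesive_power_rel :: "nat set \<Rightarrow> nat ring \<Rightarrow> ((nat \<rightharpoonup> nat) \<times> (nat \<rightharpoonup> nat)) set" where
  "cohesive_power_rel C A =
     {(\<phi>, \<psi>). \<phi> \<in> cohesive_power_maps C A \<and> \<psi> \<in> cohesive_power_maps C A \<and>
        C \<subseteq>\<^sup>* {i. \<exists>v. \<phi> i = Some v \<and> \<psi> i = Some v}}"

abbreviation cohesive_power_class ::
    "nat set \<Rightarrow> nat ring \<Rightarrow> (nat \<rightharpoonup> nat) \<Rightarrow> (nat \<rightharpoonup> nat) set" where
  "cohesive_power_class C A \<phi> \<equiv> cohesive_power_rel C A `` {\<phi>}"

definition pointwise :: "(nat \<Rightarrow> nat \<Rightarrow> nat) \<Rightarrow> (nat \<rightharpoonup> nat) \<Rightarrow> (nat \<rightharpoonup> nat) \<Rightarrow> (nat \<rightharpoonup> nat)" where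
  "pointwise f \<phi> \<psi> =
     (\<lambda>i. case (\<phi> i, \<psi> i) of (Some a, Some b) \<Rightarrow> Some (f a b) | _ \<Rightarrow> None)"

text \<open>
  Operations on classes are unions over all representatives; on the carrier every representative
  contributes the same class.
\<close>

definition cohesive_power :: "nat set \<Rightarrow> nat ring \<Rightarrow> (nat \<rightharpoonup> nat) set ring" where
  "cohesive_power C A =
     \<lparr> carrier = cohesive_power_maps C A // cohesive_power_rel C A,
       monoid.mult = (\<lambda>U V. \<Union>\<phi>\<in>U. \<Union>\<psi>\<in>V. cohesive_power_class C A (pointwise (\<otimes>\<^bsub>A\<^esub>) \<phi> \<psi>)),
       monoid.one = cohesive_power_class C A (\<lambda>_. Some \<one>\<^bsub>A\<^esub>),
       ring.zero = cohesive_power_class C A (\<lambda>_. Some \<zero>\<^bsub>A\<^esub>),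
       ring.add = (\<lambda>U V. \<Union>\<phi>\<in>U. \<Union>\<psi>\<in>V. cohesive_power_class C A (pointwise (\<oplus>\<^bsub>A\<^esub>) \<phi> \<psi>)) \<rparr>"

text \<open>The map \<open>[\<alpha>] \<mapsto> [\<Psi> \<circ> \<alpha>]\<close> into the cohesive power of \<open>K\<close>.\<close>

definition cohesive_power_embedding ::
    "nat set \<Rightarrow> nat ring \<Rightarrow> (nat \<Rightarrow> nat) \<Rightarrow> (nat \<rightharpoonup> nat) set \<Rightarrow> (nat \<rightharpoonup> nat) set" where
  "cohesive_power_embedding C K \<Psi> U =
     (\<Union>\<alpha>\<in>U. cohesive_power_class C K (map_option \<Psi> \<circ> \<alpha>))"

end

theory Submission
  imports Defs
begin

text \<open>
  Let \<open>\<alpha> i\<close> be the least element of \<open>K\<close> of degree greater than \<open>i ^ i\<close>, and let \<open>\<phi> n\<close> be the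
  computable function sending \<open>i\<close> to the power \<open>i ^ n\<close> of \<open>\<alpha> i\<close>. Kronecker substitution shows that the
  classes \<open>[\<phi> 0], [\<phi> 1], \<dots>\<close> are algebraically independent: for large \<open>i\<close>, substituting
  \<open>\<phi> 0 i, \<dots>, \<phi> (N - 1) i\<close> in the \<open>i\<close>-th component of a polynomial sends its monomials to distinct
  powers of \<open>\<alpha> i\<close>, because an exponent vector with entries below \<open>i\<close> is read as a number in base
  \<open>i\<close>. All these powers have exponent below \<open>i ^ N \<le> i ^ i\<close>, hence below the degree of \<open>\<alpha> i\<close>, so they
  are linearly independent over \<open>F\<close>. By Zorn's lemma this infinite family extends to a transcendence
  basis.
\<close>

section \<open>Total recursive functions\<close>

definition recfun :: "nat \<Rightarrow> (nat list \<Rightarrow> nat) \<Rightarrow> bool" where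
  "recfun n f \<longleftrightarrow> (\<exists>p. \<forall>xs. length xs = n \<longrightarrow> recf_eval p xs = Some (f xs))"

definition recrel :: "nat \<Rightarrow> (nat list \<Rightarrow> bool) \<Rightarrow> bool" where
  "recrel n P \<longleftrightarrow> recfun n (\<lambda>xs. of_bool (P xs))"

section \<open>Closure under composition and primitive recursion\<close>

lemma recfun_cong:
  assumes "recfun n f" and "\<And>xs. length xs = n \<Longrightarrow> f xs = g xs"
  shows "recfun n g"
  using assms unfolding recfun_def by fastforce

lemma recfun_nth: "i < n \<Longrightarrow> recfun n (\<lambda>xs. xs ! i)"
  unfolding recfun_def by (intro exI[of _ "Proj i"]) auto

lemma recfun_comp1:
  assumes "recfun 1 (\<lambda>xs. f (xs ! 0))" and "recfun n g"
  shows "recfun n (\<lambda>xs. f (g xs))"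
proof -
  obtain p q where "\<And>xs. length xs = 1 \<Longrightarrow> recf_eval p xs = Some (f (xs ! 0))"
      and "\<And>xs. length xs = n \<Longrightarrow> recf_eval q xs = Some (g xs)"
    using assms unfolding recfun_def by blast
  then show ?thesis
    unfolding recfun_def by (intro exI[of _ "Comp p [q]"]) auto
qed

lemma recfun_comp2:
  assumes "recfun 2 (\<lambda>xs. f (xs ! 0) (xs ! 1))" and "recfun n g" and "recfun n h"
  shows "recfun n (\<lambda>xs. f (g xs) (h xs))"
proof -
  obtain p q r where "\<And>xs. length xs = 2 \<Longrightarrow> recf_eval p xs = Some (f (xs ! 0) (xs ! 1))"
      and "\<And>xs. length xs = n \<Longrightarrow> recf_eval q xs = Some (g xs)"
      and "\<And>xs. length xs = n \<Longrightarrow> recf_eval r xs = Some (h xs)"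
    using assms unfolding recfun_def by blast
  then show ?thesis
    unfolding recfun_def by (intro exI[of _ "Comp p [q, r]"]) auto
qed

lemma recfun_Suc: "recfun n f \<Longrightarrow> recfun n (\<lambda>xs. Suc (f xs))"
  by (rule recfun_comp1[where f = Suc])
    (auto simp: recfun_def length_Suc_conv intro!: exI[of _ Succ])

lemma recfun_const: "recfun n (\<lambda>xs. c)"
proof (induction c)
  case 0
  then show ?case unfolding recfun_def by (intro exI[of _ Zero]) auto
qed (rule recfun_Suc)

text \<open>Recursion runs on the first argument, as in \<open>PrimRec\<close>; the second is a
  parameter. Power and difference, which recurse on their second argument, are obtained by swapping
  the arguments in \<open>recfun_comp2\<close>.\<close>

lemma recfun_primrec:
  assumes "recfun 1 (\<lambda>xs. f (xs ! 0))" and "recfun 3 (\<lambda>xs. g (xs ! 0) (xs ! 1) (xs ! 2))"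
  shows "recfun 2 (\<lambda>xs. rec_nat (f (xs ! 1)) (\<lambda>k v. g k v (xs ! 1)) (xs ! 0))"
proof -
  obtain p q where p: "\<And>xs. length xs = 1 \<Longrightarrow> recf_eval p xs = Some (f (xs ! 0))"
      and q: "\<And>xs. length xs = 3 \<Longrightarrow> recf_eval q xs = Some (g (xs ! 0) (xs ! 1) (xs ! 2))"
    using assms unfolding recfun_def by blast
  \<comment> \<open>Totality of \<open>p\<close> and \<open>q\<close> collapses the recursion on
    options to one on numbers.\<close>
  have "rec_nat (recf_eval p [y])
          (\<lambda>k r. case r of None \<Rightarrow> None | Some v \<Rightarrow> recf_eval q [k, v, y]) n =
        Some (rec_nat (f y) (\<lambda>k v. g k v y) n)" for y n
    by (induction n) (simp_all add: p q)
  then show ?thesis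
    unfolding recfun_def
    by (intro exI[of _ "PrimRec p q"]) (auto simp: numeral_2_eq_2 length_Suc_conv)
qed

section \<open>Arithmetic and pairing\<close>

lemma recfun_add:
  assumes "recfun n f" and "recfun n g"
  shows "recfun n (\<lambda>xs. f xs + g xs)"
proof -
  have eq: "rec_nat y (\<lambda>k v. Suc v) x = x + y" for x y :: nat
    by (induction x) auto
  have "recfun 2 (\<lambda>xs. rec_nat (xs ! 1) (\<lambda>k v. Suc v) (xs ! 0))"
    by (intro recfun_primrec[where f = "\<lambda>x. x" and g = "\<lambda>k v y. Suc v"] recfun_Suc recfun_nth) auto
  then show ?thesis
    unfolding eq using assms by (rule recfun_comp2[where f = "(+)"])
qed

lemma recfun_mult:
  assumes "recfun n f" and "recfun n g"
  shows "recfun n (\<lambda>xs. f xs * g xs)"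
proof -
  have eq: "rec_nat 0 (\<lambda>k v. v + y) x = x * y" for x y :: nat
    by (induction x) auto
  have "recfun 2 (\<lambda>xs. rec_nat 0 (\<lambda>k v. v + xs ! 1) (xs ! 0))"
    by (intro recfun_primrec[where f = "\<lambda>x. 0" and g = "\<lambda>k v y. v + y"]
        recfun_add recfun_nth recfun_const) auto
  then show ?thesis
    unfolding eq using assms by (rule recfun_comp2[where f = "(*)"])
qed

lemma recfun_power:
  assumes "recfun n f" and "recfun n g"
  shows "recfun n (\<lambda>xs. f xs ^ g xs)"
proof -
  have eq: "rec_nat 1 (\<lambda>k v. v * y) x = y ^ x" for x y :: nat
    by (induction x) auto
  have "recfun 2 (\<lambda>xs. rec_nat 1 (\<lambda>k v. v * xs ! 1) (xs ! 0))"
    by (intro recfun_primrec[where f = "\<lambda>x. 1" and g = "\<lambda>k v y. v * y"]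
        recfun_mult recfun_nth recfun_const) auto
  then show ?thesis
    unfolding eq using assms(2,1) by (rule recfun_comp2[where f = "\<lambda>x y. y ^ x"])
qed

lemma recfun_diff:
  assumes "recfun n f" and "recfun n g"
  shows "recfun n (\<lambda>xs. f xs - g xs)"
proof -
  \<comment> \<open>For the predecessor, the recursion step ignores the previous value and returns
    the counter.\<close>
  have pred_eq: "rec_nat 0 (\<lambda>k v. k) x = x - 1" for x :: nat
    by (cases x) auto
  have "recfun 2 (\<lambda>xs. rec_nat 0 (\<lambda>k v. k) (xs ! 0))"
    by (intro recfun_primrec[where f = "\<lambda>x. 0" and g = "\<lambda>k v y. k"] recfun_nth recfun_const) auto
  then have pred: "recfun 3 (\<lambda>xs. xs ! 1 - 1)"
    unfolding pred_eq
    by (rule recfun_comp2[where f = "\<lambda>x y. x - 1" and h = "\<lambda>xs. xs ! 0"]) (auto intro: recfun_nth)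
  have eq: "rec_nat y (\<lambda>k v. v - 1) x = y - x" for x y :: nat
    by (induction x) auto
  have "recfun 2 (\<lambda>xs. rec_nat (xs ! 1) (\<lambda>k v. v - 1) (xs ! 0))"
    by (intro recfun_primrec[where f = "\<lambda>x. x" and g = "\<lambda>k v y. v - 1"] recfun_nth pred) auto
  then show ?thesis
    unfolding eq using assms(2,1) by (rule recfun_comp2[where f = "\<lambda>x y. y - x"])
qed

text \<open>The pairing function is \<open>triangle (a + b) + a\<close>, and triangular numbers
  arise by adding \<open>Suc k\<close> at stage \<open>k\<close>.\<close>

lemma recfun_prod_encode:
  assumes "recfun n f" and "recfun n g"
  shows "recfun n (\<lambda>xs. prod_encode (f xs, g xs))"
proof -
  have eq: "rec_nat 0 (\<lambda>k v. v + Suc k) x = triangle x" for x :: nat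
    by (induction x) auto
  have "recfun 2 (\<lambda>xs. rec_nat 0 (\<lambda>k v. v + Suc k) (xs ! 0))"
    by (intro recfun_primrec[where f = "\<lambda>x. 0" and g = "\<lambda>k v y. v + Suc k"]
        recfun_add recfun_Suc recfun_nth recfun_const) auto
  then have "recfun n (\<lambda>xs. triangle (f xs + g xs))"
    unfolding eq
    by (rule recfun_comp2[where f = "\<lambda>x y. triangle x" and h = f]) (intro recfun_add assms)+
  then show ?thesis
    unfolding prod_encode_def split using assms(1) by (rule recfun_add)
qed

section \<open>Decidable relations, minimisation and definition by cases\<close>

lemma recrel_not:
  assumes "recrel n P"
  shows "recrel n (\<lambda>xs. \<not> P xs)"
proof -
  have "recfun n (\<lambda>xs. 1 - of_bool (P xs))"
    using assms unfolding recrel_def by (intro recfun_diff recfun_const)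
  then show ?thesis
    unfolding recrel_def by (rule recfun_cong) simp
qed

text \<open>\<open>Mu\<close> searches for a zero, so \<open>p\<close> computes the characteristic
  function of the negation of \<open>P\<close>. As \<open>p\<close> converges for every
  \<open>z\<close>, all tests before the least solution have a value.\<close>

lemma recf_eval_Mu:
  assumes p: "\<And>z. recf_eval p (z # xs) = Some (of_bool (\<not> P z))" and ex: "\<exists>z. P z"
  shows "recf_eval (Mu p) xs = Some (LEAST z. P z)"
proof -
  define Q where "Q z \<longleftrightarrow> P z \<and> (\<forall>y<z. \<not> P y)" for z
  have "Q z \<longleftrightarrow> z = (LEAST z. P z)" for z
    unfolding Q_def using ex by (metis LeastI_ex Least_equality leI not_less_Least)
  moreover have "recf_eval p (z # xs) = Some 0 \<and> (\<forall>y<z. \<exists>v. recf_eval p (y # xs) = Some (Suc v))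
      \<longleftrightarrow> Q z" for z
    unfolding p Q_def by auto
  moreover have "(LEAST z. z = c) = c" for c :: nat
    by (rule Least_equality) auto
  ultimately show ?thesis
    by (simp add: Let_def)
qed

lemma recfun_Least:
  assumes "recrel 2 (\<lambda>xs. P (xs ! 0) (xs ! 1))" and ex: "\<And>x. \<exists>z. P z x"
  shows "recfun 1 (\<lambda>xs. LEAST z. P z (xs ! 0))"
proof -
  obtain p where p: "recf_eval p [z, x] = Some (of_bool (\<not> P z x))" for z x
  proof -
    obtain p where "\<And>xs. length xs = 2 \<Longrightarrow>
        recf_eval p xs = Some (of_bool (\<not> P (xs ! 0) (xs ! 1)))"
      using recrel_not[OF assms(1)] unfolding recrel_def recfun_def by blast
    from this[of "[_, _]"] show ?thesis
      by (intro that[of p]) simp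
  qed
  show ?thesis
    unfolding recfun_def using recf_eval_Mu[of p, OF p ex]
    by (intro exI[of _ "Mu p"]) (auto simp: length_Suc_conv simp del: recf_eval.simps)
qed

lemma recfun_Least2:
  assumes "recrel 3 (\<lambda>xs. P (xs ! 0) (xs ! 1) (xs ! 2))" and ex: "\<And>x y. \<exists>z. P z x y"
  shows "recfun 2 (\<lambda>xs. LEAST z. P z (xs ! 0) (xs ! 1))"
proof -
  obtain p where p: "recf_eval p [z, x, y] = Some (of_bool (\<not> P z x y))" for z x y
  proof -
    obtain p where "\<And>xs. length xs = 3 \<Longrightarrow>
        recf_eval p xs = Some (of_bool (\<not> P (xs ! 0) (xs ! 1) (xs ! 2)))"
      using recrel_not[OF assms(1)] unfolding recrel_def recfun_def by blast
    from this[of "[_, _, _]"] show ?thesis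
      by (intro that[of p]) simp
  qed
  show ?thesis
    unfolding recfun_def using recf_eval_Mu[of p, OF p ex]
    by (intro exI[of _ "Mu p"])
      (auto simp: numeral_2_eq_2 length_Suc_conv simp del: recf_eval.simps)
qed

lemma recrel_conj: "recrel n P \<Longrightarrow> recrel n Q \<Longrightarrow> recrel n (\<lambda>xs. P xs \<and> Q xs)"
  unfolding recrel_def of_bool_conj by (intro recfun_mult)

lemma recrel_disj: "recrel n P \<Longrightarrow> recrel n Q \<Longrightarrow> recrel n (\<lambda>xs. P xs \<or> Q xs)"
  using recrel_not[OF recrel_conj[OF recrel_not recrel_not]] by simp

lemma recrel_less:
  assumes "recfun n f" and "recfun n g"
  shows "recrel n (\<lambda>xs. f xs < g xs)"
proof -
  \<comment> \<open>With truncated subtraction, \<open>1 - (1 - d)\<close> is the sign of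
    \<open>d\<close>.\<close>
  have "recfun n (\<lambda>xs. 1 - (1 - (g xs - f xs)))"
    by (intro recfun_diff recfun_const assms)
  then show ?thesis
    unfolding recrel_def by (rule recfun_cong) auto
qed

lemma recrel_computable_set:
  assumes "computable_set A" and "recfun n f"
  shows "recrel n (\<lambda>xs. f xs \<in> A)"
proof -
  have "recfun 1 (\<lambda>xs. of_bool (xs ! 0 \<in> A))"
  proof -
    obtain p where "\<And>x. recf_eval p [x] = Some (if x \<in> A then 1 else 0)"
      using assms(1) unfolding computable_set_def partial_computable_def by blast
    then show ?thesis
      unfolding recfun_def by (intro exI[of _ p]) (auto simp: length_Suc_conv)
  qed
  then show ?thesis
    unfolding recrel_def using assms(2) by (rule recfun_comp1[where f = "\<lambda>x. of_bool (x \<in> A)"])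
qed

text \<open>The characteristic function and its complement act as weights that select one of two
  values, both of which are defined.\<close>

lemma recfun_if:
  assumes "recrel n P" and "recfun n f" and "recfun n g"
  shows "recfun n (\<lambda>xs. if P xs then f xs else g xs)"
proof -
  have "recfun n (\<lambda>xs. of_bool (P xs) * f xs + (1 - of_bool (P xs)) * g xs)"
    using assms unfolding recrel_def
    by (intro recfun_add recfun_mult recfun_diff recfun_const)
  then show ?thesis
    by (rule recfun_cong) simp
qed

text \<open>
  Functions given on a computable set are made total by sending everything outside to a default, so
  that minimisation and primitive recursion are only ever applied to total functions.
\<close>

lemma recfun_computable_on:
  assumes "computable_on A f" and "computable_set A" and "c \<in> A" and "recfun n g"
  shows "recfun n (\<lambda>xs. f (if g xs \<in> A then g xs else c))"
proof -
  define h where "h = (\<lambda>xs. if g xs \<in> A then g xs else c)"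
  have "recfun n h"
    unfolding h_def using assms by (intro recfun_if recrel_computable_set recfun_const)
  then obtain q where q: "\<And>xs. length xs = n \<Longrightarrow> recf_eval q xs = Some (h xs)"
    unfolding recfun_def by blast
  obtain p where p: "\<And>x. recf_eval p [x] = (if x \<in> A then Some (f x) else None)"
    using assms(1) unfolding computable_on_def partial_computable_def by blast
  have "h xs \<in> A" for xs
    using assms(3) by (simp add: h_def)
  then have "recfun n (\<lambda>xs. f (h xs))"
    unfolding recfun_def by (intro exI[of _ "Comp p [q]"]) (simp add: p q)
  then show ?thesis
    unfolding h_def .
qed

section \<open>Partial computable functions of one argument\<close>

lemma partial_computable_Some:
  "recfun 1 (\<lambda>xs. f (xs ! 0)) \<Longrightarrow> partial_computable (\<lambda>i. Some (f i))"
  unfolding recfun_def partial_computable_def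
  by (metis One_nat_def length_Cons list.size(3) nth_Cons_0)

lemma partial_computable_map_option:
  assumes "recfun 1 (\<lambda>xs. f (xs ! 0))" and "partial_computable \<phi>"
  shows "partial_computable (map_option f \<circ> \<phi>)"
proof -
  obtain p q where "\<And>xs. length xs = 1 \<Longrightarrow> recf_eval p xs = Some (f (xs ! 0))"
      and "\<And>x. recf_eval q [x] = \<phi> x"
    using assms unfolding recfun_def partial_computable_def by blast
  then show ?thesis
    unfolding partial_computable_def
    by (intro exI[of _ "Comp p [q]"]) (auto split: option.split)
qed

lemma partial_computable_pointwise:
  assumes "recfun 2 (\<lambda>xs. f (xs ! 0) (xs ! 1))"
    and "partial_computable \<phi>" and "partial_computable \<psi>"
  shows "partial_computable (pointwise f \<phi> \<psi>)"
proof -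
  obtain p q r where "\<And>xs. length xs = 2 \<Longrightarrow> recf_eval p xs = Some (f (xs ! 0) (xs ! 1))"
      and "\<And>x. recf_eval q [x] = \<phi> x" and "\<And>x. recf_eval r [x] = \<psi> x"
    using assms unfolding recfun_def partial_computable_def by blast
  then show ?thesis
    unfolding partial_computable_def pointwise_def
    by (intro exI[of _ "Comp p [q, r]"]) (auto split: option.split)
qed

section \<open>Computable fields\<close>

text \<open>Distinct tags and the injectivity of pairing let a term be read back from its code, so
  that membership in the atomic diagram becomes a statement about terms.\<close>

lemma term_code_inj: "term_code s = term_code t \<Longrightarrow> s = t"
proof (induction s arbitrary: t)
  case (TConst a)
  then show ?case by (cases t) (auto simp: prod_encode_eq)
next
  case TZero
  then show ?case by (cases t) (auto simp: prod_encode_eq)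
next
  case TOne
  then show ?case by (cases t) (auto simp: prod_encode_eq)
next
  case (TAdd s1 s2)
  then show ?case by (cases t) (auto simp: prod_encode_eq)
next
  case (TMult s1 s2)
  then show ?case by (cases t) (auto simp: prod_encode_eq)
qed

lemma true_equation_in_atomic_diagram_iff:
  "prod_encode (1, prod_encode (term_code s, term_code t)) \<in> atomic_diagram R \<longleftrightarrow>
     set_ring_term s \<subseteq> carrier R \<and> set_ring_term t \<subseteq> carrier R \<and> term_value R s = term_value R t"
  unfolding atomic_diagram_def
  by (auto simp: prod_encode_eq dest!: term_code_inj split: if_splits)

text \<open>The value \<open>f x y\<close> is found by searching for a \<open>z\<close> such that
  the diagram contains the equation between \<open>T\<close> applied to the constants
  \<open>x\<close>, \<open>y\<close> and the constant \<open>z\<close>. Outside the carrier every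
  \<open>z\<close> is accepted, so the search always stops, there at 0. \<open>T\<close> stands for
  \<open>TAdd\<close> or \<open>TMult\<close>.\<close>

lemma recfun_binop:
  assumes "computable_field R"
    and code: "\<And>s t. term_code (T s t) = prod_encode (k, prod_encode (term_code s, term_code t))"
    and val: "\<And>s t. term_value R (T s t) = f (term_value R s) (term_value R t)"
    and set: "\<And>s t. set_ring_term (T s t) = set_ring_term s \<union> set_ring_term t"
    and closed: "\<And>x y. x \<in> carrier R \<Longrightarrow> y \<in> carrier R \<Longrightarrow> f x y \<in> carrier R"
  shows "recfun 2 (\<lambda>xs. if xs ! 0 \<in> carrier R \<and> xs ! 1 \<in> carrier R then f (xs ! 0) (xs ! 1) else 0)"
proof -
  define P where "P z x y \<longleftrightarrow> \<not> (x \<in> carrier R \<and> y \<in> carrier R) \<or>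
      prod_encode (1, prod_encode (term_code (T (TConst x) (TConst y)), term_code (TConst z)))
        \<in> atomic_diagram R" for z x y
  have P_iff: "P z x y \<longleftrightarrow> \<not> (x \<in> carrier R \<and> y \<in> carrier R) \<or> z = f x y" for z x y
    unfolding P_def true_equation_in_atomic_diagram_iff by (auto simp: val set closed)
  have "recrel 3 (\<lambda>xs. P (xs ! 0) (xs ! 1) (xs ! 2))"
    using assms(1) unfolding P_def code term_code.simps computable_field_def
    by (intro recrel_disj recrel_not recrel_conj recrel_computable_set recfun_prod_encode
        recfun_const recfun_nth) auto
  moreover have "\<exists>z. P z x y" for x y
    unfolding P_iff by blast
  ultimately have "recfun 2 (\<lambda>xs. LEAST z. P z (xs ! 0) (xs ! 1))"
    by (rule recfun_Least2)
  moreover have "(LEAST z. P z x y) = (if x \<in> carrier R \<and> y \<in> carrier R then f x y else 0)" for x y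
    unfolding P_iff by (auto intro: Least_equality)
  ultimately show ?thesis
    by (simp only:)
qed

lemma
  assumes "computable_field R"
  shows recfun_add_field: "recfun 2 (\<lambda>xs. if xs ! 0 \<in> carrier R \<and> xs ! 1 \<in> carrier R
            then xs ! 0 \<oplus>\<^bsub>R\<^esub> xs ! 1 else 0)"
    and recfun_mult_field: "recfun 2 (\<lambda>xs. if xs ! 0 \<in> carrier R \<and> xs ! 1 \<in> carrier R
            then xs ! 0 \<otimes>\<^bsub>R\<^esub> xs ! 1 else 0)"
proof -
  interpret field R
    using assms by (simp add: computable_field_def)
  show "recfun 2 (\<lambda>xs. if xs ! 0 \<in> carrier R \<and> xs ! 1 \<in> carrier R
            then xs ! 0 \<oplus>\<^bsub>R\<^esub> xs ! 1 else 0)"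
    by (rule recfun_binop[where T = TAdd and k = 3, OF assms]) auto
  show "recfun 2 (\<lambda>xs. if xs ! 0 \<in> carrier R \<and> xs ! 1 \<in> carrier R
            then xs ! 0 \<otimes>\<^bsub>R\<^esub> xs ! 1 else 0)"
    by (rule recfun_binop[where T = TMult and k = 4, OF assms]) auto
qed

lemma recfun_power_field:
  assumes R: "computable_field R" and "recfun n f" and "recfun n g"
    and closed: "\<And>xs. f xs \<in> carrier R"
  shows "recfun n (\<lambda>xs. f xs [^]\<^bsub>R\<^esub> g xs)"
proof -
  interpret field R
    using R by (simp add: computable_field_def)
  \<comment> \<open>\<open>m\<close> extends multiplication to a total function, to which primitive
    recursion on the exponent applies; starting from a base in the carrier, the default is never
    reached.\<close>
  define m where "m x y = (if x \<in> carrier R \<and> y \<in> carrier R then x \<otimes>\<^bsub>R\<^esub> y else 0)" for x y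
  have m: "recfun n' (\<lambda>xs. m (f xs) (g xs))" if "recfun n' f" "recfun n' g" for f g n'
    using recfun_mult_field[OF R] that unfolding m_def
    by (rule recfun_comp2[where f = "\<lambda>x y. if x \<in> carrier R \<and> y \<in> carrier R then x \<otimes>\<^bsub>R\<^esub> y else 0"])
  have "recfun 2 (\<lambda>xs. rec_nat \<one>\<^bsub>R\<^esub> (\<lambda>k v. m v (xs ! 1)) (xs ! 0))"
    by (intro recfun_primrec[where f = "\<lambda>x. \<one>\<^bsub>R\<^esub>" and g = "\<lambda>k v y. m v y"] m recfun_nth recfun_const)
      auto
  then have "recfun n (\<lambda>xs. rec_nat \<one>\<^bsub>R\<^esub> (\<lambda>k v. m v (f xs)) (g xs))"
    using assms(3,2) by (rule recfun_comp2[where f = "\<lambda>e x. rec_nat \<one>\<^bsub>R\<^esub> (\<lambda>k v. m v x) e"])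
  moreover have "rec_nat \<one>\<^bsub>R\<^esub> (\<lambda>k v. m v x) e = x [^]\<^bsub>R\<^esub> e" if "x \<in> carrier R" for x e
    using that by (induction e) (auto simp: m_def)
  ultimately show ?thesis
    using closed by simp
qed

section \<open>Cohesive powers\<close>

text \<open>The filter of all sets that contain almost all of \<open>C\<close>. Almost inclusion of
  \<open>C\<close> becomes an eventuality, and finite exceptional sets are absorbed by the rules for
  \<open>eventually\<close>.\<close>

definition cofinite_in :: "nat set \<Rightarrow> nat filter" where
  "cofinite_in C = inf cofinite (principal C)"

lemma almost_subset_iff_eventually: "C \<subseteq>\<^sup>* A \<longleftrightarrow> (\<forall>\<^sub>F i in cofinite_in C. i \<in> A)"
  unfolding almost_subset_def cofinite_in_def eventually_inf_principal eventually_cofinite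
  by (simp add: set_diff_eq)

lemma cohesive_power_rel_iff:
  "(\<phi>, \<psi>) \<in> cohesive_power_rel C R \<longleftrightarrow> \<phi> \<in> cohesive_power_maps C R \<and>
     \<psi> \<in> cohesive_power_maps C R \<and> (\<forall>\<^sub>F i in cofinite_in C. \<exists>v. \<phi> i = Some v \<and> \<psi> i = Some v)"
  unfolding cohesive_power_rel_def almost_subset_iff_eventually by simp

lemma cohesive_power_maps_iff:
  "\<phi> \<in> cohesive_power_maps C R \<longleftrightarrow> partial_computable \<phi> \<and> ran \<phi> \<subseteq> carrier R \<and>
     (\<forall>\<^sub>F i in cofinite_in C. \<exists>v. \<phi> i = Some v)"
  unfolding cohesive_power_maps_def almost_subset_iff_eventually by (simp add: dom_def)

lemma equiv_cohesive_power_rel: "equiv (cohesive_power_maps C R) (cohesive_power_rel C R)"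
proof (rule equivI)
  show "cohesive_power_rel C R \<subseteq> cohesive_power_maps C R \<times> cohesive_power_maps C R"
    by (auto simp: cohesive_power_rel_iff)
  show "refl_on (cohesive_power_maps C R) (cohesive_power_rel C R)"
    by (auto simp: refl_on_def cohesive_power_rel_iff cohesive_power_maps_iff)
  show "sym (cohesive_power_rel C R)"
    by (auto simp: sym_def cohesive_power_rel_iff conj_commute)
  show "trans (cohesive_power_rel C R)"
    by (auto simp: trans_def cohesive_power_rel_iff elim: eventually_elim2)
qed

text \<open>
  \<open>f\<close> is a total, not necessarily computable, function that agrees almost everywhere on \<open>C\<close> with
  the representatives of the class \<open>U\<close>.
\<close>

definition germ :: "nat set \<Rightarrow> nat ring \<Rightarrow> (nat \<rightharpoonup> nat) set \<Rightarrow> (nat \<Rightarrow> nat) \<Rightarrow> bool" where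
  "germ C R U f \<longleftrightarrow> range f \<subseteq> carrier R \<and>
     (\<exists>\<phi>\<in>cohesive_power_maps C R. U = cohesive_power_class C R \<phi> \<and>
        (\<forall>\<^sub>F i in cofinite_in C. \<phi> i = Some (f i)))"

lemma germ_carrier: "germ C R U f \<Longrightarrow> U \<in> carrier (cohesive_power C R)"
  unfolding germ_def cohesive_power_def by (auto intro: quotientI)

lemma germ_total:
  assumes "recfun 1 (\<lambda>xs. f (xs ! 0))" and "range f \<subseteq> carrier R"
  shows "germ C R (cohesive_power_class C R (\<lambda>i. Some (f i))) f"
  unfolding germ_def using assms partial_computable_Some[OF assms(1)]
  by (auto simp: cohesive_power_maps_iff ran_def image_subset_iff intro!: bexI[of _ "\<lambda>i. Some (f i)"])

text \<open>Where a representative diverges, the default \<open>z\<close> is taken; on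
  \<open>C\<close> this happens only finitely often. The resulting total function may fail to be
  computable, which \<open>germ\<close> permits.\<close>

lemma germ_exists:
  assumes U: "U \<in> carrier (cohesive_power C R)" and "z \<in> carrier R"
  obtains f where "germ C R U f"
proof -
  obtain \<phi> where \<phi>: "\<phi> \<in> cohesive_power_maps C R" "U = cohesive_power_class C R \<phi>"
    using U by (auto simp: cohesive_power_def elim: quotientE)
  then have "\<forall>\<^sub>F i in cofinite_in C. \<phi> i = Some (case \<phi> i of Some v \<Rightarrow> v | None \<Rightarrow> z)"
    by (auto simp: cohesive_power_maps_iff elim: eventually_mono)
  moreover have "range (\<lambda>i. case \<phi> i of Some v \<Rightarrow> v | None \<Rightarrow> z) \<subseteq> carrier R"
    using \<phi>(1) assms(2) by (auto simp: cohesive_power_maps_iff subset_iff ranI split: option.split)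
  ultimately show thesis
    using \<phi> that unfolding germ_def by blast
qed

text \<open>Equality in the cohesive power is thereby tested componentwise; all later arguments pass
  between the power and its components through this equivalence.\<close>

lemma germ_eq_iff:
  assumes "germ C R U f" and "germ C R V g"
  shows "U = V \<longleftrightarrow> (\<forall>\<^sub>F i in cofinite_in C. f i = g i)"
proof -
  obtain \<phi> \<psi> where *: "\<phi> \<in> cohesive_power_maps C R" "U = cohesive_power_class C R \<phi>"
      "\<psi> \<in> cohesive_power_maps C R" "V = cohesive_power_class C R \<psi>"
    and ev: "\<forall>\<^sub>F i in cofinite_in C. \<phi> i = Some (f i)" "\<forall>\<^sub>F i in cofinite_in C. \<psi> i = Some (g i)"
    using assms unfolding germ_def by blast
  have "U = V \<longleftrightarrow> (\<forall>\<^sub>F i in cofinite_in C. \<exists>v. \<phi> i = Some v \<and> \<psi> i = Some v)"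
    using * by (simp add: eq_equiv_class_iff[OF equiv_cohesive_power_rel] cohesive_power_rel_iff)
  also have "\<dots> \<longleftrightarrow> (\<forall>\<^sub>F i in cofinite_in C. f i = g i)"
    by (rule eventually_cong[OF eventually_conj[OF ev]]) auto
  finally show ?thesis .
qed

text \<open>The operations of \<open>cohesive_power\<close> are unions over representatives. Since
  the class of the pointwise result does not depend on the representatives, such a union is a single
  class, and its components are computed by \<open>h\<close>.\<close>

lemma germ_pointwise:
  assumes U: "germ C R U f" and V: "germ C R V g"
    and op: "recfun 2 (\<lambda>xs. if xs ! 0 \<in> carrier R \<and> xs ! 1 \<in> carrier R
               then h (xs ! 0) (xs ! 1) else 0)"
    and closed: "\<And>x y. x \<in> carrier R \<Longrightarrow> y \<in> carrier R \<Longrightarrow> h x y \<in> carrier R"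
  shows "germ C R (\<Union>\<phi>\<in>U. \<Union>\<psi>\<in>V. cohesive_power_class C R (pointwise h \<phi> \<psi>)) (\<lambda>i. h (f i) (g i))"
proof -
  have maps: "pointwise h \<phi> \<psi> \<in> cohesive_power_maps C R"
    if "\<phi> \<in> cohesive_power_maps C R" and "\<psi> \<in> cohesive_power_maps C R" for \<phi> \<psi>
  proof -
    have \<phi>: "partial_computable \<phi>" "ran \<phi> \<subseteq> carrier R" "\<forall>\<^sub>F i in cofinite_in C. \<exists>v. \<phi> i = Some v"
      and \<psi>: "partial_computable \<psi>" "ran \<psi> \<subseteq> carrier R" "\<forall>\<^sub>F i in cofinite_in C. \<exists>v. \<psi> i = Some v"
      using that by (auto simp: cohesive_power_maps_iff)
    have vals: "v \<in> carrier R" if "\<phi> i = Some v \<or> \<psi> i = Some v" for i v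
      using \<phi>(2) \<psi>(2) that by (auto simp: ran_def)
    \<comment> \<open>Representatives take values in the carrier only, so the computable total
      extension of \<open>h\<close> gives the same partial function as \<open>h\<close>
      itself.\<close>
    have "pointwise (\<lambda>x y. if x \<in> carrier R \<and> y \<in> carrier R then h x y else 0) \<phi> \<psi> = pointwise h \<phi> \<psi>"
      using vals by (auto simp: pointwise_def fun_eq_iff split: option.split)
    with partial_computable_pointwise[OF op \<phi>(1) \<psi>(1)]
    have "partial_computable (pointwise h \<phi> \<psi>)"
      by simp
    moreover have "ran (pointwise h \<phi> \<psi>) \<subseteq> carrier R"
    proof
      fix w
      assume "w \<in> ran (pointwise h \<phi> \<psi>)"
      then obtain i where "pointwise h \<phi> \<psi> i = Some w"
        by (auto simp: ran_def)
      then show "w \<in> carrier R"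
        using vals[of i] closed by (cases "\<phi> i"; cases "\<psi> i") (auto simp: pointwise_def)
    qed
    moreover have "\<forall>\<^sub>F i in cofinite_in C. \<exists>v. pointwise h \<phi> \<psi> i = Some v"
      using \<phi>(3) \<psi>(3) by eventually_elim (auto simp: pointwise_def)
    ultimately show ?thesis
      by (simp add: cohesive_power_maps_iff)
  qed
  have cong: "congruent2 (cohesive_power_rel C R) (cohesive_power_rel C R)
      (\<lambda>\<phi> \<psi>. cohesive_power_class C R (pointwise h \<phi> \<psi>))"
  proof (rule congruent2I')
    fix \<phi> \<phi>' \<psi> \<psi>'
    assume "(\<phi>, \<phi>') \<in> cohesive_power_rel C R" and "(\<psi>, \<psi>') \<in> cohesive_power_rel C R"
    then have maps': "\<phi> \<in> cohesive_power_maps C R" "\<phi>' \<in> cohesive_power_maps C R"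
        "\<psi> \<in> cohesive_power_maps C R" "\<psi>' \<in> cohesive_power_maps C R"
      and ev: "\<forall>\<^sub>F i in cofinite_in C. \<exists>v. \<phi> i = Some v \<and> \<phi>' i = Some v"
        "\<forall>\<^sub>F i in cofinite_in C. \<exists>v. \<psi> i = Some v \<and> \<psi>' i = Some v"
      by (auto simp: cohesive_power_rel_iff)
    from ev have "\<forall>\<^sub>F i in cofinite_in C. \<exists>v. pointwise h \<phi> \<psi> i = Some v \<and> pointwise h \<phi>' \<psi>' i = Some v"
      by eventually_elim (auto simp: pointwise_def)
    then show "cohesive_power_class C R (pointwise h \<phi> \<psi>) =
        cohesive_power_class C R (pointwise h \<phi>' \<psi>')"
      using maps' maps by (intro equiv_class_eq[OF equiv_cohesive_power_rel])
        (simp add: cohesive_power_rel_iff)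
  qed
  obtain \<phi> \<psi> where *: "\<phi> \<in> cohesive_power_maps C R" "U = cohesive_power_class C R \<phi>"
      "\<psi> \<in> cohesive_power_maps C R" "V = cohesive_power_class C R \<psi>"
    and ev: "\<forall>\<^sub>F i in cofinite_in C. \<phi> i = Some (f i)" "\<forall>\<^sub>F i in cofinite_in C. \<psi> i = Some (g i)"
    using U V unfolding germ_def by blast
  have "(\<Union>\<phi>\<in>U. \<Union>\<psi>\<in>V. cohesive_power_class C R (pointwise h \<phi> \<psi>)) =
      cohesive_power_class C R (pointwise h \<phi> \<psi>)"
    using * by (simp add: UN_equiv_class2[OF equiv_cohesive_power_rel equiv_cohesive_power_rel cong])
  moreover have "\<forall>\<^sub>F i in cofinite_in C. pointwise h \<phi> \<psi> i = Some (h (f i) (g i))"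
    using ev by eventually_elim (auto simp: pointwise_def)
  moreover have "range (\<lambda>i. h (f i) (g i)) \<subseteq> carrier R"
    using U V closed unfolding germ_def by (auto simp: image_subset_iff)
  ultimately show ?thesis
    using maps *(1,3) unfolding germ_def by blast
qed

text \<open>As for the binary operations, the union over representatives collapses to one class
  because composition with \<Psi> respects almost everywhere equality.\<close>

lemma germ_embedding:
  assumes hom: "\<Psi> \<in> ring_hom F K" and "computable_on (carrier F) \<Psi>"
    and F: "computable_field F" and U: "germ C F U \<beta>"
  shows "germ C K (cohesive_power_embedding C K \<Psi> U) (\<lambda>i. \<Psi> (\<beta> i))"
proof -
  interpret F: field F
    using F by (simp add: computable_field_def)
  have maps: "map_option \<Psi> \<circ> \<alpha> \<in> cohesive_power_maps C K" if "\<alpha> \<in> cohesive_power_maps C F" for \<alpha>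
  proof -
    have \<alpha>: "partial_computable \<alpha>" "ran \<alpha> \<subseteq> carrier F" "\<forall>\<^sub>F i in cofinite_in C. \<exists>v. \<alpha> i = Some v"
      using that by (auto simp: cohesive_power_maps_iff)
    have vals: "v \<in> carrier F" if "\<alpha> i = Some v" for i v
      using \<alpha>(2) that by (auto simp: ran_def)
    have "recfun 1 (\<lambda>xs. \<Psi> (if xs ! 0 \<in> carrier F then xs ! 0 else \<zero>\<^bsub>F\<^esub>))"
      using assms(2) F by (intro recfun_computable_on recfun_nth) (auto simp: computable_field_def)
    \<comment> \<open>The computable total extension of \<Psi> agrees with \<Psi> on the values of
      \<alpha>, which lie in \<open>carrier F\<close>.\<close>
    from partial_computable_map_option[OF this \<alpha>(1)]
    have "partial_computable (map_option \<Psi> \<circ> \<alpha>)"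
      by (rule back_subst[of partial_computable]) (auto simp: fun_eq_iff vals intro!: option.map_cong)
    moreover have "ran (map_option \<Psi> \<circ> \<alpha>) \<subseteq> carrier K"
      using vals hom by (auto simp: ran_def ring_hom_def)
    ultimately show ?thesis
      using \<alpha>(3) by (auto simp: cohesive_power_maps_iff elim: eventually_mono)
  qed
  have cong: "(\<lambda>\<alpha>. cohesive_power_class C K (map_option \<Psi> \<circ> \<alpha>)) respects cohesive_power_rel C F"
  proof (rule congruentI)
    fix \<alpha> \<alpha>'
    assume "(\<alpha>, \<alpha>') \<in> cohesive_power_rel C F"
    then show "cohesive_power_class C K (map_option \<Psi> \<circ> \<alpha>) =
        cohesive_power_class C K (map_option \<Psi> \<circ> \<alpha>')"
      using maps by (intro equiv_class_eq[OF equiv_cohesive_power_rel])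
        (auto simp: cohesive_power_rel_iff elim: eventually_mono)
  qed
  obtain \<alpha> where \<alpha>: "\<alpha> \<in> cohesive_power_maps C F" "U = cohesive_power_class C F \<alpha>"
      "\<forall>\<^sub>F i in cofinite_in C. \<alpha> i = Some (\<beta> i)"
    using U unfolding germ_def by blast
  have "cohesive_power_embedding C K \<Psi> U = cohesive_power_class C K (map_option \<Psi> \<circ> \<alpha>)"
    unfolding cohesive_power_embedding_def \<alpha>(2)
    by (rule UN_equiv_class[OF equiv_cohesive_power_rel cong \<alpha>(1)])
  moreover have "\<forall>\<^sub>F i in cofinite_in C. (map_option \<Psi> \<circ> \<alpha>) i = Some (\<Psi> (\<beta> i))"
    using \<alpha>(3) by eventually_elim simp
  moreover have "range (\<lambda>i. \<Psi> (\<beta> i)) \<subseteq> carrier K"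
    using U hom unfolding germ_def by (auto simp: ring_hom_def)
  ultimately show ?thesis
    using maps[OF \<alpha>(1)] unfolding germ_def by blast
qed

section \<open>Ring structure, powers, finite sums and products\<close>

context
  fixes R :: "nat ring" and C :: "nat set"
  assumes R: "computable_field R"
begin

interpretation R: field R
  using R by (simp add: computable_field_def)

lemma germ_mult:
  "germ C R U f \<Longrightarrow> germ C R V g \<Longrightarrow>
     germ C R (U \<otimes>\<^bsub>cohesive_power C R\<^esub> V) (\<lambda>i. f i \<otimes>\<^bsub>R\<^esub> g i)"
  using germ_pointwise[OF _ _ recfun_mult_field[OF R] R.m_closed, of C]
  by (simp add: cohesive_power_def)

lemma germ_add:
  "germ C R U f \<Longrightarrow> germ C R V g \<Longrightarrow>
     germ C R (U \<oplus>\<^bsub>cohesive_power C R\<^esub> V) (\<lambda>i. f i \<oplus>\<^bsub>R\<^esub> g i)"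
  using germ_pointwise[OF _ _ recfun_add_field[OF R] R.a_closed, of C]
  by (simp add: cohesive_power_def)

lemma germ_zero: "germ C R \<zero>\<^bsub>cohesive_power C R\<^esub> (\<lambda>i. \<zero>\<^bsub>R\<^esub>)"
  unfolding cohesive_power_def by (auto intro!: germ_total recfun_const)

lemma germ_one: "germ C R \<one>\<^bsub>cohesive_power C R\<^esub> (\<lambda>i. \<one>\<^bsub>R\<^esub>)"
  unfolding cohesive_power_def by (auto intro!: germ_total recfun_const)

lemma germ_eqI: "germ C R U f \<Longrightarrow> germ C R V g \<Longrightarrow> (\<And>i. f i = g i) \<Longrightarrow> U = V"
  using germ_eq_iff[of C R U f V g] by simp

text \<open>Every element has a germ, and germs commute with the operations. Each axiom therefore
  reduces to the same identity in \<open>R\<close>, component by component.\<close>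

lemma cohesive_power_cring: "cring (cohesive_power C R)" (is "cring ?L")
proof -
  note intros = germ_mult germ_add germ_zero germ_one
  have ex: "\<exists>f. germ C R U f" if "U \<in> carrier ?L" for U
    by (rule germ_exists[OF that R.zero_closed]) (rule exI)
  have rng: "f i \<in> carrier R" if "germ C R U f" for U f i
    using that by (auto simp: germ_def)
  have minus: "\<exists>V\<in>carrier ?L. V \<oplus>\<^bsub>?L\<^esub> U = \<zero>\<^bsub>?L\<^esub>" if U: "U \<in> carrier ?L" for U
  proof -
    obtain f where f: "germ C R U f"
      using ex[OF U] by blast
    \<comment> \<open>Negatives are products with the constant class of -1, so they come from the
      computability of multiplication.\<close>
    have m1: "germ C R (cohesive_power_class C R (\<lambda>i. Some (\<ominus>\<^bsub>R\<^esub> \<one>\<^bsub>R\<^esub>))) (\<lambda>i. \<ominus>\<^bsub>R\<^esub> \<one>\<^bsub>R\<^esub>)"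
      by (intro germ_total recfun_const) auto
    have "cohesive_power_class C R (\<lambda>i. Some (\<ominus>\<^bsub>R\<^esub> \<one>\<^bsub>R\<^esub>)) \<otimes>\<^bsub>?L\<^esub> U \<oplus>\<^bsub>?L\<^esub> U = \<zero>\<^bsub>?L\<^esub>"
      by (rule germ_eqI[OF germ_add[OF germ_mult[OF m1 f] f] germ_zero])
        (simp add: rng[OF f] R.l_minus R.l_neg)
    then show ?thesis
      using germ_carrier[OF germ_mult[OF m1 f]] by blast
  qed
  show ?thesis
  proof (intro cringI abelian_groupI comm_monoidI)
    fix U V W
    assume UVW: "U \<in> carrier ?L" "V \<in> carrier ?L" "W \<in> carrier ?L"
    obtain f where f: "germ C R U f" using ex[OF UVW(1)] by blast
    obtain g where g: "germ C R V g" using ex[OF UVW(2)] by blast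
    obtain h where h: "germ C R W h" using ex[OF UVW(3)] by blast
    note r = rng[OF f] rng[OF g] rng[OF h]
    show "(U \<oplus>\<^bsub>?L\<^esub> V) \<oplus>\<^bsub>?L\<^esub> W = U \<oplus>\<^bsub>?L\<^esub> (V \<oplus>\<^bsub>?L\<^esub> W)"
      by (rule germ_eqI) (rule intros f g h | simp add: r R.a_assoc)+
    show "(U \<otimes>\<^bsub>?L\<^esub> V) \<otimes>\<^bsub>?L\<^esub> W = U \<otimes>\<^bsub>?L\<^esub> (V \<otimes>\<^bsub>?L\<^esub> W)"
      by (rule germ_eqI) (rule intros f g h | simp add: r R.m_assoc)+
    show "(U \<oplus>\<^bsub>?L\<^esub> V) \<otimes>\<^bsub>?L\<^esub> W = U \<otimes>\<^bsub>?L\<^esub> W \<oplus>\<^bsub>?L\<^esub> V \<otimes>\<^bsub>?L\<^esub> W"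
      by (rule germ_eqI) (rule intros f g h | simp add: r R.l_distr)+
  next
    fix U V
    assume UV: "U \<in> carrier ?L" "V \<in> carrier ?L"
    obtain f where f: "germ C R U f" using ex[OF UV(1)] by blast
    obtain g where g: "germ C R V g" using ex[OF UV(2)] by blast
    note r = rng[OF f] rng[OF g]
    show "U \<oplus>\<^bsub>?L\<^esub> V \<in> carrier ?L" "U \<otimes>\<^bsub>?L\<^esub> V \<in> carrier ?L"
      by (rule germ_carrier, rule intros, rule f, rule g)+
    show "U \<oplus>\<^bsub>?L\<^esub> V = V \<oplus>\<^bsub>?L\<^esub> U"
      by (rule germ_eqI) (rule intros f g | simp add: r R.a_comm)+
    show "U \<otimes>\<^bsub>?L\<^esub> V = V \<otimes>\<^bsub>?L\<^esub> U"
      by (rule germ_eqI) (rule intros f g | simp add: r R.m_comm)+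
  next
    fix U
    assume U: "U \<in> carrier ?L"
    obtain f where f: "germ C R U f" using ex[OF U] by blast
    note r = rng[OF f]
    show "\<zero>\<^bsub>?L\<^esub> \<oplus>\<^bsub>?L\<^esub> U = U"
      by (rule germ_eqI) (rule intros f | simp add: r)+
    show "\<one>\<^bsub>?L\<^esub> \<otimes>\<^bsub>?L\<^esub> U = U"
      by (rule germ_eqI) (rule intros f | simp add: r)+
    show "\<exists>V\<in>carrier ?L. V \<oplus>\<^bsub>?L\<^esub> U = \<zero>\<^bsub>?L\<^esub>"
      using minus[OF U] .
  qed (intro germ_carrier[OF germ_zero] germ_carrier[OF germ_one])+
qed

interpretation L: cring "cohesive_power C R"
  by (rule cohesive_power_cring)

lemma germ_power:
  assumes "germ C R U f"
  shows "germ C R (U [^]\<^bsub>cohesive_power C R\<^esub> (k::nat)) (\<lambda>i. f i [^]\<^bsub>R\<^esub> k)"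
  by (induction k) (simp_all add: germ_one germ_mult assms)

lemma germ_finsum:
  assumes "finite J" and "\<And>j. j \<in> J \<Longrightarrow> germ C R (U j) (f j)"
  shows "germ C R (\<Oplus>\<^bsub>cohesive_power C R\<^esub>j\<in>J. U j) (\<lambda>i. \<Oplus>\<^bsub>R\<^esub>j\<in>J. f j i)"
  using assms
proof (induction J)
  case empty
  then show ?case by (simp add: germ_zero)
next
  case (insert j J)
  have "U \<in> J \<rightarrow> carrier (cohesive_power C R)" "U j \<in> carrier (cohesive_power C R)"
    using insert.prems germ_carrier by blast+
  moreover have "f j' i \<in> carrier R" if "j' \<in> insert j J" for j' i
    using insert.prems[OF that] by (auto simp: germ_def)
  ultimately show ?case
    using insert germ_add[of "U j" "f j"] by (simp add: Pi_def)
qed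

lemma germ_finprod:
  assumes "finite J" and "\<And>j. j \<in> J \<Longrightarrow> germ C R (U j) (f j)"
  shows "germ C R (\<Otimes>\<^bsub>cohesive_power C R\<^esub>j\<in>J. U j) (\<lambda>i. \<Otimes>\<^bsub>R\<^esub>j\<in>J. f j i)"
  using assms
proof (induction J)
  case empty
  then show ?case by (simp add: germ_one)
next
  case (insert j J)
  have "U \<in> J \<rightarrow> carrier (cohesive_power C R)" "U j \<in> carrier (cohesive_power C R)"
    using insert.prems germ_carrier by blast+
  moreover have "f j' i \<in> carrier R" if "j' \<in> insert j J" for j' i
    using insert.prems[OF that] by (auto simp: germ_def)
  ultimately show ?case
    using insert germ_mult[of "U j" "f j"] by (simp add: Pi_def)
qed

end

section \<open>Uniqueness of power representations\<close>

text \<open>Translates the list form of linear combinations into a finite sum.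
  \<open>exp_base\<close> lists the highest power first, hence the reversed index list.\<close>

lemma (in ring) combine_exp_base:
  assumes "x \<in> carrier R" and "\<And>j. j < n \<Longrightarrow> a j \<in> carrier R"
  shows "combine (map a (rev [0..<n])) (exp_base x n) = (\<Oplus>j\<in>{..<n}. a j \<otimes> x [^] j)"
  using assms(2)
proof (induction n)
  case 0
  then show ?case by (simp add: exp_base_def)
next
  case (Suc n)
  have "(\<Oplus>j\<in>{..<Suc n}. a j \<otimes> x [^] j) = a n \<otimes> x [^] n \<oplus> (\<Oplus>j\<in>{..<n}. a j \<otimes> x [^] j)"
    unfolding lessThan_Suc using assms(1) Suc.prems by (subst finsum_insert) (auto intro!: Pi_I)
  with Suc show ?case
    by (simp add: exp_base_def)
qed

text \<open>A nontrivial relation would give a nonzero polynomial that vanishes at \<open>x\<close>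
  and has smaller degree than the minimal polynomial; \<open>exp_base_independent\<close> excludes
  this.\<close>

lemma (in domain) powers_independent:
  assumes "subfield k R" and "x \<in> carrier R" and "(algebraic over k) x"
    and a: "\<And>j. j < degree (Irr k x) \<Longrightarrow> a j \<in> k"
    and sum: "(\<Oplus>j\<in>{..<degree (Irr k x)}. a j \<otimes> x [^] j) = \<zero>"
    and j: "j < degree (Irr k x)"
  shows "a j = \<zero>"
proof -
  define n where "n = degree (Irr k x)"
  have sub: "k \<subseteq> carrier R"
    using subfieldE(3)[OF assms(1)] .
  have ind: "independent k (exp_base x n)"
    using exp_base_independent[OF assms(1-3)] unfolding n_def .
  have "combine (map a (rev [0..<n])) (exp_base x n) = \<zero>"
    using sum a sub assms(2) unfolding n_def by (subst combine_exp_base) auto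
  then have "set (take (length (exp_base x n)) (map a (rev [0..<n]))) \<subseteq> {\<zero>}"
    using a by (intro independent_imp_trivial_combine[OF assms(1) ind]) (auto simp: n_def)
  moreover have "length (exp_base x n) = n"
    by (simp add: exp_base_def)
  ultimately show ?thesis
    using j by (auto simp: n_def image_subset_iff)
qed

text \<open>The index set is arbitrary because it will consist of monomials, with \<open>e\<close>
  giving their exponents after Kronecker substitution. The difference of the two sides is a
  vanishing combination of distinct powers below the degree.\<close>

lemma (in domain) power_combination_unique:
  fixes e :: "'i \<Rightarrow> nat"
  assumes k: "subfield k R" and x: "x \<in> carrier R" "(algebraic over k) x"
    and M: "finite M" "inj_on e M" "\<And>m. m \<in> M \<Longrightarrow> e m < degree (Irr k x)"
    and c: "\<And>m. m \<in> M \<Longrightarrow> c m \<in> k" "\<And>m. m \<in> M \<Longrightarrow> c' m \<in> k"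
    and sum: "(\<Oplus>m\<in>M. c m \<otimes> x [^] e m) = (\<Oplus>m\<in>M. c' m \<otimes> x [^] e m)"
    and m: "m \<in> M"
  shows "c m = c' m"
proof -
  have sub: "k \<subseteq> carrier R"
    using subfieldE(3)[OF k] .
  have ring: "subring k R"
    using subfieldE(1)[OF k] .
  have carr: "c m \<in> carrier R" "c' m \<in> carrier R" if "m \<in> M" for m
    using c[OF that] sub by auto
  define d where "d m = c m \<ominus> c' m" for m
  have d: "d m \<in> k" if "m \<in> M" for m
    using c[OF that] subringE(5,7)[OF ring] unfolding d_def a_minus_def by blast
  then have d_carr: "d m \<in> carrier R" if "m \<in> M" for m
    using that sub by blast
  have "(\<Oplus>m\<in>M. d m \<otimes> x [^] e m) \<oplus> (\<Oplus>m\<in>M. c' m \<otimes> x [^] e m) =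
      (\<Oplus>m\<in>M. d m \<otimes> x [^] e m \<oplus> c' m \<otimes> x [^] e m)"
    using carr d_carr x(1) by (intro finsum_addf[symmetric]) auto
  also have "\<dots> = (\<Oplus>m\<in>M. c m \<otimes> x [^] e m)"
  proof (rule finsum_cong')
    fix m
    assume "m \<in> M"
    note * = carr[OF this] d_carr[OF this]
    have "d m \<oplus> c' m = c m"
      using * unfolding d_def a_minus_def by (simp add: a_assoc l_neg)
    then show "d m \<otimes> x [^] e m \<oplus> c' m \<otimes> x [^] e m = c m \<otimes> x [^] e m"
      using * x(1) by (simp flip: l_distr)
  qed (use carr x(1) in auto)
  finally have sum_d: "(\<Oplus>m\<in>M. d m \<otimes> x [^] e m) = \<zero>"
    using sum carr d_carr x(1) by (simp add: Pi_def)
  \<comment> \<open>The coefficients are moved from \<open>M\<close> to exponents along the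
    injection \<open>e\<close>; exponents outside the image receive zero, so the sum can range over
    all exponents below the degree.\<close>
  define a where "a j = (if j \<in> e ` M then d (the_inv_into M e j) else \<zero>)" for j
  have a_e: "a (e m) = d m" if "m \<in> M" for m
    using that M(2) by (simp add: a_def the_inv_into_f_f)
  have a: "a j \<in> k" for j
    using a_e d subringE(2)[OF ring] by (cases "j \<in> e ` M") (auto simp: a_def)
  then have a_carr: "a j \<in> carrier R" for j
    using sub by blast
  have "(\<Oplus>j\<in>{..<degree (Irr k x)}. a j \<otimes> x [^] j) = (\<Oplus>j\<in>e ` M. a j \<otimes> x [^] j)"
    using M(3) a_carr x(1) by (intro add.finprod_mono_neutral_cong_right) (auto simp: a_def)
  also have "\<dots> = (\<Oplus>m\<in>M. a (e m) \<otimes> x [^] e m)"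
    using a_carr x(1) M(2) by (intro finsum_reindex) auto
  also have "\<dots> = (\<Oplus>m\<in>M. d m \<otimes> x [^] e m)"
    using d_carr x(1) by (intro finsum_cong') (auto simp: a_e)
  finally have "a (e m) = \<zero>"
    using powers_independent[OF k x(1,2) a _ M(3)[OF m]] sum_d by simp
  then have "c m \<ominus> c' m = \<zero>"
    using a_e[OF m] by (simp add: d_def)
  then show ?thesis
    using carr[OF m] by simp
qed

text \<open>If two distinct exponents gave the same power, the indicator functions
  \<open>?c a\<close> and \<open>?c b\<close> would be two different coefficient families on
  \<open>{a, b}\<close> with equal sums.\<close>

lemma (in domain) powers_inj:
  assumes "subfield k R" and "x \<in> carrier R" and "(algebraic over k) x"
  shows "inj_on (\<lambda>e::nat. x [^] e) {..<degree (Irr k x)}"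
proof (rule inj_onI, rule ccontr)
  fix a b :: nat
  assume lt: "a \<in> {..<degree (Irr k x)}" "b \<in> {..<degree (Irr k x)}"
    and eq: "x [^] a = x [^] b" and "a \<noteq> b"
  let ?c = "\<lambda>(a::nat) m. if m = a then \<one> else \<zero>"
  have k: "\<one> \<in> k" "\<zero> \<in> k"
    using subringE(2,3)[OF subfieldE(1)[OF assms(1)]] by auto
  have "?c a a = ?c b a"
    using lt eq assms(2) \<open>a \<noteq> b\<close> k
    by (intro power_combination_unique[OF assms, where M = "{a, b}" and e = "\<lambda>m. m"
          and c = "?c a" and c' = "?c b"]) auto
  then show False
    using \<open>a \<noteq> b\<close> by simp
qed

section \<open>Products of powers and expansions in base \<open>q\<close>\<close>

lemma (in comm_monoid) nat_pow_sum:
  assumes "x \<in> carrier G" and "finite A"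
  shows "(\<Otimes>a\<in>A. x [^] (f a :: nat)) = x [^] (\<Sum>a\<in>A. f a)"
  using assms(2) by (induction A) (use assms(1) in \<open>auto simp: nat_pow_mult Pi_def\<close>)

text \<open>Reduction modulo \<open>q\<close> isolates the lowest digit; removing it and dividing by
  \<open>q\<close> leaves a shorter expansion.\<close>

lemma digits_unique:
  fixes a b :: "nat \<Rightarrow> nat"
  assumes "(\<Sum>n<N. a n * q ^ n) = (\<Sum>n<N. b n * q ^ n)"
    and "\<And>n. n < N \<Longrightarrow> a n < q" and "\<And>n. n < N \<Longrightarrow> b n < q" and "n < N"
  shows "a n = b n"
  using assms
proof (induction N arbitrary: a b n)
  case (Suc N)
  have split: "(\<Sum>n<Suc N. f n * q ^ n) = f 0 + q * (\<Sum>n<N. f (Suc n) * q ^ n)" for f :: "nat \<Rightarrow> nat"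
    by (simp add: sum.lessThan_Suc_shift sum_distrib_left mult_ac del: sum.lessThan_Suc)
  have eq: "a 0 + q * (\<Sum>n<N. a (Suc n) * q ^ n) = b 0 + q * (\<Sum>n<N. b (Suc n) * q ^ n)"
    using Suc.prems(1) unfolding split .
  have "a 0 < q" "b 0 < q"
    using Suc.prems by auto
  then have "a 0 = b 0"
    using arg_cong[OF eq, of "\<lambda>x. x mod q"] by simp
  with eq \<open>a 0 < q\<close> have "(\<Sum>n<N. a (Suc n) * q ^ n) = (\<Sum>n<N. b (Suc n) * q ^ n)"
    by simp
  then have "a (Suc n) = b (Suc n)" if "n < N" for n
    using that Suc.prems(2,3) by (intro Suc.IH[of "\<lambda>n. a (Suc n)" "\<lambda>n. b (Suc n)"]) auto
  with \<open>a 0 = b 0\<close> Suc.prems(4) show ?case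
    by (cases n) auto
qed simp

lemma digits_less:
  fixes a :: "nat \<Rightarrow> nat"
  assumes "\<And>n. n < N \<Longrightarrow> a n < q"
  shows "(\<Sum>n<N. a n * q ^ n) < q ^ N"
  using assms
proof (induction N)
  case (Suc N)
  have "(\<Sum>n<Suc N. a n * q ^ n) < q ^ N + a N * q ^ N"
    using Suc by simp
  also have "\<dots> = Suc (a N) * q ^ N"
    by simp
  also have "\<dots> \<le> q * q ^ N"
    using Suc.prems[of N] by (intro mult_right_mono) auto
  finally show ?case
    by simp
qed simp

section \<open>Indexed polynomials and algebraic independence\<close>

context ring
begin

section \<open>Variables, support and coefficients of indexed polynomials\<close>

lemma indexed_pset_mono:
  "P \<in> indexed_pset I k \<Longrightarrow> I \<subseteq> J \<Longrightarrow> P \<in> indexed_pset J k"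
  by (induction rule: indexed_pset.induct) (auto intro: indexed_pset.intros)

text \<open>For Zorn's lemma: the finitely many variables of a polynomial over the union of a chain
  already lie in one member of the chain.\<close>

lemma indexed_pset_finite_index:
  assumes "P \<in> indexed_pset I k"
  obtains J where "finite J" "J \<subseteq> I" "P \<in> indexed_pset J k"
proof -
  from assms have "\<exists>J. finite J \<and> J \<subseteq> I \<and> P \<in> indexed_pset J k"
  proof (induction rule: indexed_pset.induct)
    case (indexed_const c)
    then show ?case by (blast intro: indexed_pset.indexed_const)
  next
    case (indexed_padd P Q)
    then obtain J J' where "finite J" "J \<subseteq> I" "P \<in> indexed_pset J k"
        "finite J'" "J' \<subseteq> I" "Q \<in> indexed_pset J' k"
      by blast
    then show ?case
      by (intro exI[of _ "J \<union> J'"]) (auto intro: indexed_pset.indexed_padd indexed_pset_mono)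
  next
    case (indexed_pmult P i)
    then obtain J where "finite J" "J \<subseteq> I" "P \<in> indexed_pset J k"
      by blast
    with indexed_pmult show ?case
      by (intro exI[of _ "insert i J"])
        (auto intro: indexed_pset.indexed_pmult indexed_pset_mono)
  qed
  then show thesis
    using that by blast
qed

lemma indexed_pset_support:
  assumes "P \<in> indexed_pset I k"
  shows "finite {m. P m \<noteq> \<zero>} \<and> (\<forall>m. P m \<noteq> \<zero> \<longrightarrow> set_mset m \<subseteq> I)"
  using assms
proof (induction rule: indexed_pset.induct)
  case (indexed_const c)
  have "{m. indexed_const c m \<noteq> \<zero>} \<subseteq> {{#}}"
    by (auto simp: indexed_const_def)
  then show ?case
    by (auto simp: indexed_const_def intro: finite_subset)
next
  case (indexed_padd P Q)
  have *: "P m \<noteq> \<zero> \<or> Q m \<noteq> \<zero>" if "indexed_padd P Q m \<noteq> \<zero>" for m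
    using that by (auto simp: indexed_padd_def)
  then have "{m. indexed_padd P Q m \<noteq> \<zero>} \<subseteq> {m. P m \<noteq> \<zero>} \<union> {m. Q m \<noteq> \<zero>}"
    by blast
  with indexed_padd.IH * show ?case
    by (meson finite_UnI finite_subset)
next
  case (indexed_pmult P i)
  have *: "i \<in># m \<and> P (m - {#i#}) \<noteq> \<zero>" if "indexed_pmult P i m \<noteq> \<zero>" for m
    using that by (auto simp: indexed_pmult_def split: if_splits)
  \<comment> \<open>Multiplication by the variable \<open>i\<close> shifts the support by adding
    \<open>i\<close> to each monomial.\<close>
  have "{m. indexed_pmult P i m \<noteq> \<zero>} \<subseteq> add_mset i ` {m. P m \<noteq> \<zero>}"
    using * by (auto intro!: image_eqI[where x = "_ - {#i#}"])
  moreover have "set_mset m \<subseteq> I" if "indexed_pmult P i m \<noteq> \<zero>" for m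
  proof -
    have "m = add_mset i (m - {#i#})"
      using *[OF that] by simp
    moreover have "set_mset (m - {#i#}) \<subseteq> I"
      using *[OF that] indexed_pmult.IH by blast
    ultimately show ?thesis
      using indexed_pmult.hyps by (metis insert_subset set_mset_add_mset_insert)
  qed
  ultimately show ?case
    using indexed_pmult.IH by (meson finite_imageI finite_subset)
qed

text \<open>Building a polynomial only adds coefficients, while multiplication by a variable merely
  moves them. An additively closed set containing \<open>k\<close> and zero thus captures all of
  them.\<close>

lemma indexed_pset_coeff:
  assumes "P \<in> indexed_pset I k" and "k \<subseteq> S" and "\<zero> \<in> S"
    and "\<And>x y. x \<in> S \<Longrightarrow> y \<in> S \<Longrightarrow> x \<oplus> y \<in> S"
  shows "P m \<in> S"
  using assms(1)
proof (induction arbitrary: m rule: indexed_pset.induct)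
  case (indexed_const c)
  then show ?case using assms(2,3) by (auto simp: indexed_const_def)
next
  case (indexed_padd P Q)
  then show ?case using assms(4) by (simp add: indexed_padd_def)
next
  case (indexed_pmult P i)
  then show ?case using assms(3) by (simp add: indexed_pmult_def)
qed

text \<open>Polynomials as lists start with the leading coefficient, so the coefficient of the
  \<open>j\<close>-th power sits at position \<open>length p - Suc j\<close>.\<close>

lemma eval_eq_finsum:
  assumes "set p \<subseteq> carrier R" and "x \<in> carrier R"
  shows "eval p x = (\<Oplus>j\<in>{..<length p}. p ! (length p - Suc j) \<otimes> x [^] j)"
  using assms(1)
proof (induction p)
  case (Cons c p)
  have carr: "(c # p) ! j \<in> carrier R" if "j < Suc (length p)" for j
    using Cons.prems nth_mem[of j "c # p"] that by auto
  have "(\<Oplus>j\<in>{..<length (c # p)}. (c # p) ! (length (c # p) - Suc j) \<otimes> x [^] j) =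
      c \<otimes> x [^] length p \<oplus> (\<Oplus>j\<in>{..<length p}. (c # p) ! (length (c # p) - Suc j) \<otimes> x [^] j)"
    unfolding list.size add_Suc_right lessThan_Suc add_0_right
    using assms(2) Cons.prems
    by (subst finsum_insert) (auto intro!: Pi_I m_closed carr)
  also have "(\<Oplus>j\<in>{..<length p}. (c # p) ! (length (c # p) - Suc j) \<otimes> x [^] j) = 
      (\<Oplus>j\<in>{..<length p}. p ! (length p - Suc j) \<otimes> x [^] j)"
    using assms(2) carr
    by (intro finsum_cong') (auto simp: nth_Cons' intro!: Pi_I m_closed carr[of "Suc _", simplified])
  finally show ?case
    using Cons by simp
qed simp

lemma transcendental_overI:
  assumes x: "x \<in> carrier R" and "k \<subseteq> S" and "\<zero> \<in> S" and "S \<subseteq> carrier R"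
    and unique: "\<And>n c c' j. (\<And>j. j < n \<Longrightarrow> c j \<in> S) \<Longrightarrow> (\<And>j. j < n \<Longrightarrow> c' j \<in> S) \<Longrightarrow>
      (\<Oplus>j\<in>{..<n}. c j \<otimes> x [^] j) = (\<Oplus>j\<in>{..<n}. c' j \<otimes> x [^] j) \<Longrightarrow> j < (n::nat) \<Longrightarrow> c j = c' j"
  shows "(transcendental over k) x"
  unfolding transcendental_def over_def
proof (rule inj_onI)
  fix p q
  assume "p \<in> carrier (k[X])" and "q \<in> carrier (k[X])" and eq: "eval p x = eval q x"
  then have p: "polynomial k p" and q: "polynomial k q"
    by (simp_all add: univ_poly_carrier)
  \<comment> \<open>Leading zeros bring both lists to a common length without changing their values
    at \<open>x\<close>; normalisation strips them again at the end.\<close>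
  define p' q' where "p' = replicate (length q) \<zero> @ p" and "q' = replicate (length p) \<zero> @ q"
  have set: "set p \<subseteq> S" "set q \<subseteq> S" "set p' \<subseteq> S" "set q' \<subseteq> S"
    using polynomial_incl[OF p] polynomial_incl[OF q] assms(2,3) by (auto simp: p'_def q'_def)
  have len: "length p' = length p + length q" "length q' = length p + length q"
    by (simp_all add: p'_def q'_def)
  let ?n = "length p + length q"
  have "eval p' x = eval q' x"
    using eq x set(1,2) assms(4) unfolding p'_def q'_def by (simp add: eval_replicate)
  then have "(\<Oplus>j\<in>{..<?n}. p' ! (?n - Suc j) \<otimes> x [^] j) = (\<Oplus>j\<in>{..<?n}. q' ! (?n - Suc j) \<otimes> x [^] j)"
    using eval_eq_finsum[of p' x] eval_eq_finsum[of q' x] x set(3,4) assms(4) by (simp add: len)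
  then have same: "p' ! (?n - Suc j) = q' ! (?n - Suc j)" if "j < ?n" for j
    using set(3,4) that by (intro unique[of ?n "\<lambda>j. p' ! (?n - Suc j)" "\<lambda>j. q' ! (?n - Suc j)"])
      (auto simp: len subset_iff)
  have "p' = q'"
  proof (rule nth_equalityI)
    fix i
    assume "i < length p'"
    then show "p' ! i = q' ! i"
      using same[of "?n - Suc i"] by (simp add: len)
  qed (simp add: len)
  then have "normalize p = normalize q"
    unfolding p'_def q'_def by (metis normalize_replicate_zero)
  then show "p = q"
    using normalize_polynomial[OF p] normalize_polynomial[OF q] by simp
qed

end

text \<open>Zorn's lemma is applied to the independent sets containing \<open>B\<close>. A relation
  over the union of a chain is a relation over one member, so unions of chains stay independent, and
  a maximal set contains the infinite set \<open>B\<close>.\<close>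

lemma infinite_transcendence_degreeI:
  fixes L :: "'a ring"
  assumes "ring L" and B: "algebraically_independent L k B" and "infinite B"
  shows "infinite_transcendence_degree L k"
proof -
  interpret ring L by fact
  define \<A> where "\<A> = {B'. algebraically_independent L k B' \<and> B \<subseteq> B'}"
  have "\<exists>M\<in>\<A>. \<forall>B'\<in>\<A>. M \<subseteq> B' \<longrightarrow> B' = M"
  proof (rule subset_Zorn_nonempty)
    show "\<A> \<noteq> {}"
      using B by (auto simp: \<A>_def)
  next
    fix \<C>
    assume "\<C> \<noteq> {}" and chain: "subset.chain \<A> \<C>"
    have \<C>: "\<C> \<subseteq> \<A>"
      using chain by (simp add: subset.chain_def)
    have "P = indexed_const \<zero>\<^bsub>L\<^esub>"
      if P: "P \<in> indexed_pset (\<Union>\<C>) k" and zero: "eval_at_indices L P = \<zero>\<^bsub>L\<^esub>" for P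
    proof -
      obtain J where J: "finite J" "J \<subseteq> \<Union>\<C>" "P \<in> indexed_pset J k"
        using indexed_pset_finite_index[OF P] .
      obtain B' where "B' \<in> \<C>" "J \<subseteq> B'"
        using finite_subset_Union_chain[OF J(1,2) \<open>\<C> \<noteq> {}\<close> chain] .
      then have "algebraically_independent L k B'" "P \<in> indexed_pset B' k"
        using \<C> J(3) indexed_pset_mono by (auto simp: \<A>_def)
      then show ?thesis
        using zero unfolding algebraically_independent_def by blast
    qed
    moreover have "\<Union>\<C> \<subseteq> carrier L"
      using \<C> by (auto simp: \<A>_def algebraically_independent_def)
    moreover have "B \<subseteq> \<Union>\<C>"
      using \<C> \<open>\<C> \<noteq> {}\<close> unfolding \<A>_def by blast
    ultimately show "\<Union>\<C> \<in> \<A>"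
      by (simp add: \<A>_def algebraically_independent_def)
  qed
  then obtain M where M: "M \<in> \<A>" "\<And>B'. B' \<in> \<A> \<Longrightarrow> M \<subseteq> B' \<Longrightarrow> B' = M"
    by blast
  then have "transcendence_basis L k M"
    unfolding transcendence_basis_def \<A>_def by auto
  moreover have "infinite M"
    using M(1) \<open>infinite B\<close> by (auto simp: \<A>_def dest: finite_subset)
  ultimately show ?thesis
    unfolding infinite_transcendence_degree_def by blast
qed

section \<open>Elements of unbounded degree\<close>

lemma eventually_cofinite_in_ge: "\<forall>\<^sub>F i in cofinite_in C. n \<le> i"
proof -
  have "finite {i. \<not> n \<le> i}"
    by (simp add: not_le)
  then show ?thesis
    by (auto simp: cofinite_in_def eventually_inf_principal eventually_cofinite
        elim: finite_subset[rotated])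
qed

text \<open>Properness of the filter, by which an eventual contradiction becomes an actual
  one.\<close>

lemma not_eventually_False_cofinite_in: "infinite C \<Longrightarrow> \<not> (\<forall>\<^sub>F i in cofinite_in C. False)"
  by (simp add: cofinite_in_def eventually_inf_principal eventually_cofinite)

locale unbounded_degree_extension =
  fixes K F :: "nat ring" and \<Psi> :: "nat \<Rightarrow> nat" and C :: "nat set"
  assumes extension: "computable_field_extension K F \<Psi>"
    and algebraic: "algebraic_extension K (\<Psi> ` carrier F)"
    and computable_degree: "computable_on (carrier K) (element_degree K (\<Psi> ` carrier F))"
    and infinite_C: "infinite C"
    and unbounded: "\<not> bdd_above {element_degree K (\<Psi> ` carrier F) \<alpha> | \<alpha>. \<alpha> \<in> carrier K}"
begin

abbreviation k :: "nat set" where "k \<equiv> \<Psi> ` carrier F"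

abbreviation L :: "(nat \<rightharpoonup> nat) set ring" where "L \<equiv> cohesive_power C K"

abbreviation kL :: "(nat \<rightharpoonup> nat) set set" where
  "kL \<equiv> cohesive_power_embedding C K \<Psi> ` carrier (cohesive_power C F)"

lemma computable_fields: "computable_field K" "computable_field F"
  and hom: "\<Psi> \<in> ring_hom F K" and computable_hom: "computable_on (carrier F) \<Psi>"
  using extension by (auto simp: computable_field_extension_def)

sublocale K: field K
  using computable_fields by (simp add: computable_field_def)

sublocale F: field F
  using computable_fields by (simp add: computable_field_def)

sublocale L: cring L
  by (rule cohesive_power_cring[OF computable_fields(1)])

lemma subfield_k: "subfield k K"
proof -
  interpret ring_hom_ring F K \<Psi>
    using hom by (intro ring_hom_ringI2 F.ring_axioms K.ring_axioms)
  show ?thesis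
    by (rule img_is_subfield(2)[OF F.carrier_is_subfield K.one_not_zero])
qed

text \<open>The bound \<open>i ^ i\<close> eventually dominates \<open>i ^ N\<close> for each fixed
  \<open>N\<close>, so one sequence serves polynomials in any number of variables.\<close>

definition \<alpha> :: "nat \<Rightarrow> nat" where
  "\<alpha> i = (LEAST z. z \<in> carrier K \<and> i ^ i < element_degree K k z)"

lemma ex_large_degree: "\<exists>z. z \<in> carrier K \<and> n < element_degree K k z"
  using unbounded unfolding bdd_above_def by (auto simp: not_le)

lemma \<alpha>_carrier: "\<alpha> i \<in> carrier K" and degree_\<alpha>: "i ^ i < element_degree K k (\<alpha> i)"
  using LeastI_ex[OF ex_large_degree, of "i ^ i"] unfolding \<alpha>_def by auto

text \<open>Membership in \<open>K\<close> and comparison of degrees are decidable, and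
  unboundedness of the degrees makes the search stop.\<close>

lemma recfun_\<alpha>: "recfun n f \<Longrightarrow> recfun n (\<lambda>xs. \<alpha> (f xs))"
proof (rule recfun_comp1[of \<alpha>])
  \<comment> \<open>Outside the carrier the degree is evaluated at zero to keep the test total; the
    first conjunct makes the value there irrelevant.\<close>
  define P where "P z i \<longleftrightarrow> z \<in> carrier K \<and>
      i ^ i < element_degree K k (if z \<in> carrier K then z else \<zero>\<^bsub>K\<^esub>)" for z i
  have P: "P z i \<longleftrightarrow> z \<in> carrier K \<and> i ^ i < element_degree K k z" for z i
    by (auto simp: P_def)
  have "recrel 2 (\<lambda>xs. P (xs ! 0) (xs ! 1))"
    using computable_fields(1) unfolding P_def computable_field_def
    by (intro recrel_conj recrel_less recrel_computable_set recfun_power recfun_nth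
        recfun_computable_on[OF computable_degree]) auto
  then show "recfun 1 (\<lambda>xs. \<alpha> (xs ! 0))"
    unfolding \<alpha>_def P[symmetric] by (rule recfun_Least) (simp add: P ex_large_degree)
qed

section \<open>The family of classes \<open>\<Phi> n\<close>\<close>

definition \<phi> :: "nat \<Rightarrow> nat \<Rightarrow> nat" where
  "\<phi> n i = \<alpha> i [^]\<^bsub>K\<^esub> (i ^ n)"

definition \<Phi> :: "nat \<Rightarrow> (nat \<rightharpoonup> nat) set" where
  "\<Phi> n = cohesive_power_class C K (\<lambda>i. Some (\<phi> n i))"

lemma germ_\<Phi>: "germ C K (\<Phi> n) (\<phi> n)"
  unfolding \<Phi>_def
proof (rule germ_total)
  show "recfun 1 (\<lambda>xs. \<phi> n (xs ! 0))"
    unfolding \<phi>_def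
    by (intro recfun_power_field computable_fields recfun_\<alpha> recfun_power recfun_nth recfun_const
        \<alpha>_carrier) auto
  show "range (\<phi> n) \<subseteq> carrier K"
    by (auto simp: \<phi>_def \<alpha>_carrier)
qed

lemma eventually_less_degree: "\<forall>\<^sub>F i in cofinite_in C. n < element_degree K k (\<alpha> i)"
  using eventually_cofinite_in_ge[of "Suc n" C]
proof eventually_elim
  case (elim i)
  then have "n < i ^ 1" "i ^ 1 \<le> i ^ i"
    by (simp, intro power_increasing) auto
  then show ?case
    using degree_\<alpha>[of i] by linarith
qed

lemma algebraic_\<alpha>: "(ring.algebraic K over k) (\<alpha> i)"
  using algebraic \<alpha>_carrier by (auto simp: algebraic_extension_def)

text \<open>For large \<open>i\<close> the exponents \<open>i ^ m\<close> and \<open>i ^ n\<close>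
  are distinct and below the degree of \<open>\<alpha> i\<close>, so the two powers differ.\<close>

lemma \<Phi>_inj: "inj \<Phi>"
proof (rule linorder_injI)
  fix m n :: nat
  assume "m < n"
  show "\<Phi> m \<noteq> \<Phi> n"
  proof
    assume "\<Phi> m = \<Phi> n"
    then have "\<forall>\<^sub>F i in cofinite_in C. \<phi> m i = \<phi> n i"
      using germ_eq_iff[OF germ_\<Phi> germ_\<Phi>] by blast
    then have "\<forall>\<^sub>F i in cofinite_in C. False"
      \<comment> \<open>From \<open>i \<ge> 2\<close> powers of \<open>i\<close> increase strictly,
        and \<open>i \<ge> n\<close> gives \<open>i ^ n \<le> i ^ i\<close>.\<close>
      using eventually_cofinite_in_ge[of "n + 2" C]
    proof eventually_elim
      case (elim i)
      have "i ^ m < i ^ n" "i ^ n \<le> i ^ i"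
        using elim(2) \<open>m < n\<close> by (auto intro: power_strict_increasing power_increasing)
      then have "i ^ m \<noteq> i ^ n" "i ^ m < element_degree K k (\<alpha> i)"
          "i ^ n < element_degree K k (\<alpha> i)"
        using degree_\<alpha>[of i] by auto
      then show False
        using inj_onD[OF K.powers_inj[OF subfield_k \<alpha>_carrier algebraic_\<alpha>, of i], of "i ^ m" "i ^ n"]
          elim(1)
        by (simp add: \<phi>_def element_degree_def)
    qed
    then show False
      using not_eventually_False_cofinite_in[OF infinite_C] by blast
  qed
qed

text \<open>
  \<open>S\<close> drops the computability of the representatives \<open>\<beta>\<close>. Independence holds even over \<open>S\<close>, and so
  \<open>kL\<close> need not be shown to be a subfield.
\<close>

definition S :: "(nat \<rightharpoonup> nat) set set" where
  "S = {U. \<exists>\<beta>. range \<beta> \<subseteq> carrier F \<and> germ C K U (\<lambda>i. \<Psi> (\<beta> i))}"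

section \<open>Admissible coefficients\<close>

lemma kL_subset_S: "kL \<subseteq> S"
proof
  fix U
  assume "U \<in> kL"
  then obtain V where V: "V \<in> carrier (cohesive_power C F)" "U = cohesive_power_embedding C K \<Psi> V"
    by blast
  obtain \<beta> where \<beta>: "germ C F V \<beta>"
    using germ_exists[OF V(1) F.zero_closed] .
  from germ_embedding[OF hom computable_hom computable_fields(2) this] \<beta> show "U \<in> S"
    unfolding S_def V(2) germ_def by blast
qed

lemma S_subset: "S \<subseteq> carrier L"
  by (auto simp: S_def germ_carrier)

lemma zero_in_S: "\<zero>\<^bsub>L\<^esub> \<in> S"
  using germ_zero[OF computable_fields(1), of C] F.zero_closed ring_hom_zero[OF hom F.ring_axioms K.ring_axioms]
  by (auto simp: S_def intro!: exI[of _ "\<lambda>i. \<zero>\<^bsub>F\<^esub>"])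

lemma add_in_S:
  assumes "U \<in> S" and "V \<in> S"
  shows "U \<oplus>\<^bsub>L\<^esub> V \<in> S"
proof -
  obtain \<beta> \<gamma> where *: "range \<beta> \<subseteq> carrier F" "germ C K U (\<lambda>i. \<Psi> (\<beta> i))"
      "range \<gamma> \<subseteq> carrier F" "germ C K V (\<lambda>i. \<Psi> (\<gamma> i))"
    using assms by (auto simp: S_def)
  have "(\<lambda>i. \<Psi> (\<beta> i) \<oplus>\<^bsub>K\<^esub> \<Psi> (\<gamma> i)) = (\<lambda>i. \<Psi> (\<beta> i \<oplus>\<^bsub>F\<^esub> \<gamma> i))"
    using *(1,3) by (intro ext, intro ring_hom_add[OF hom, symmetric]) auto
  with germ_add[OF computable_fields(1) *(2,4)]
  have "germ C K (U \<oplus>\<^bsub>L\<^esub> V) (\<lambda>i. \<Psi> (\<beta> i \<oplus>\<^bsub>F\<^esub> \<gamma> i))"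
    by simp
  moreover have "range (\<lambda>i. \<beta> i \<oplus>\<^bsub>F\<^esub> \<gamma> i) \<subseteq> carrier F"
    using *(1,3) by (auto simp: image_subset_iff)
  ultimately show ?thesis
    unfolding S_def by blast
qed

text \<open>Equality of the sums holds in almost every component on \<open>C\<close>, where
  \<open>power_combination_unique\<close> identifies the coefficients. The exponents may vary with
  the component \<open>i\<close>; they need to be distinct and below the degree only
  eventually.\<close>

lemma combination_unique:
  assumes "finite M" and c: "\<And>m. m \<in> M \<Longrightarrow> c m \<in> S" "\<And>m. m \<in> M \<Longrightarrow> c' m \<in> S"
    and Y: "\<And>m. m \<in> M \<Longrightarrow> germ C K (Y m) (\<lambda>i. \<alpha> i [^]\<^bsub>K\<^esub> (e m i :: nat))"
    and e: "\<forall>\<^sub>F i in cofinite_in C. inj_on (\<lambda>m. e m i) M \<and>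
              (\<forall>m\<in>M. e m i < element_degree K k (\<alpha> i))"
    and sum: "(\<Oplus>\<^bsub>L\<^esub>m\<in>M. c m \<otimes>\<^bsub>L\<^esub> Y m) = (\<Oplus>\<^bsub>L\<^esub>m\<in>M. c' m \<otimes>\<^bsub>L\<^esub> Y m)"
    and m: "m \<in> M"
  shows "c m = c' m"
proof -
  obtain \<beta> where
      \<beta>: "\<And>m. m \<in> M \<Longrightarrow> range (\<beta> m) \<subseteq> carrier F \<and> germ C K (c m) (\<lambda>i. \<Psi> (\<beta> m i))"
    using c(1) unfolding S_def mem_Collect_eq by metis
  obtain \<beta>' where
      \<beta>': "\<And>m. m \<in> M \<Longrightarrow> range (\<beta>' m) \<subseteq> carrier F \<and> germ C K (c' m) (\<lambda>i. \<Psi> (\<beta>' m i))"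
    using c(2) unfolding S_def mem_Collect_eq by metis
  note R = computable_fields(1)
  have "germ C K (\<Oplus>\<^bsub>L\<^esub>m\<in>M. c m \<otimes>\<^bsub>L\<^esub> Y m)
      (\<lambda>i. \<Oplus>\<^bsub>K\<^esub>m\<in>M. \<Psi> (\<beta> m i) \<otimes>\<^bsub>K\<^esub> \<alpha> i [^]\<^bsub>K\<^esub> e m i)"
    using assms(1) \<beta> Y by (intro germ_finsum[OF R] germ_mult[OF R]) auto
  moreover have "germ C K (\<Oplus>\<^bsub>L\<^esub>m\<in>M. c' m \<otimes>\<^bsub>L\<^esub> Y m)
      (\<lambda>i. \<Oplus>\<^bsub>K\<^esub>m\<in>M. \<Psi> (\<beta>' m i) \<otimes>\<^bsub>K\<^esub> \<alpha> i [^]\<^bsub>K\<^esub> e m i)"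
    using assms(1) \<beta>' Y by (intro germ_finsum[OF R] germ_mult[OF R]) auto
  ultimately have "\<forall>\<^sub>F i in cofinite_in C. (\<Oplus>\<^bsub>K\<^esub>m\<in>M. \<Psi> (\<beta> m i) \<otimes>\<^bsub>K\<^esub> \<alpha> i [^]\<^bsub>K\<^esub> e m i) =
      (\<Oplus>\<^bsub>K\<^esub>m\<in>M. \<Psi> (\<beta>' m i) \<otimes>\<^bsub>K\<^esub> \<alpha> i [^]\<^bsub>K\<^esub> e m i)"
    using germ_eq_iff sum by blast
  with e have "\<forall>\<^sub>F i in cofinite_in C. \<Psi> (\<beta> m i) = \<Psi> (\<beta>' m i)"
  proof eventually_elim
    case (elim i)
    have "\<beta> m i \<in> carrier F" "\<beta>' m i \<in> carrier F" if "m \<in> M" for m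
      using \<beta>[OF that] \<beta>'[OF that] by auto
    then show ?case
      using elim
      by (intro K.power_combination_unique[OF subfield_k \<alpha>_carrier algebraic_\<alpha> \<open>finite M\<close>,
            where e = "\<lambda>m. e m i" and c = "\<lambda>m. \<Psi> (\<beta> m i)" and c' = "\<lambda>m. \<Psi> (\<beta>' m i)"] m)
        (auto simp: element_degree_def)
  qed
  then show ?thesis
    using germ_eq_iff[of C K "c m" _ "c' m"] \<beta>[OF m] \<beta>'[OF m] by blast
qed

text \<open>Kronecker substitution: the \<open>i\<close>-th component of a monomial is a single
  power of \<open>\<alpha> i\<close>, whose exponent has the multiplicities of the variables as its
  digits in base \<open>i\<close>.\<close>

lemma germ_monomial:
  assumes "set_mset m \<subseteq> \<Phi> ` {..<N}"
  shows "germ C K (\<Otimes>\<^bsub>L\<^esub>U\<in>set_mset m. U [^]\<^bsub>L\<^esub> count m U)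
           (\<lambda>i. \<alpha> i [^]\<^bsub>K\<^esub> (\<Sum>n<N. count m (\<Phi> n) * i ^ n))"
proof -
  \<comment> \<open>Monomials are multisets of the classes themselves; injectivity of \<Phi>
    recovers the number of a variable.\<close>
  define idx where "idx = the_inv \<Phi>"
  have idx: "idx (\<Phi> n) = n" for n
    by (simp add: idx_def \<Phi>_inj the_inv_f_f)
  have "(\<Otimes>\<^bsub>K\<^esub>U\<in>set_mset m. \<phi> (idx U) i [^]\<^bsub>K\<^esub> count m U) =
      \<alpha> i [^]\<^bsub>K\<^esub> (\<Sum>n<N. count m (\<Phi> n) * i ^ n)" for i
  proof -
    have "(\<Otimes>\<^bsub>K\<^esub>U\<in>set_mset m. \<phi> (idx U) i [^]\<^bsub>K\<^esub> count m U) =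
        \<alpha> i [^]\<^bsub>K\<^esub> (\<Sum>U\<in>set_mset m. i ^ idx U * count m U)"
      by (simp add: \<phi>_def K.nat_pow_pow \<alpha>_carrier K.nat_pow_sum)
    \<comment> \<open>Variables that do not occur have multiplicity zero, so the sum may run over
      all \<open>N\<close> of them.\<close>
    also have "(\<Sum>U\<in>set_mset m. i ^ idx U * count m U) = (\<Sum>U\<in>\<Phi> ` {..<N}. i ^ idx U * count m U)"
      using assms by (intro sum.mono_neutral_left) (auto simp: count_eq_zero_iff)
    also have "\<dots> = (\<Sum>n<N. count m (\<Phi> n) * i ^ n)"
      using \<Phi>_inj by (subst sum.reindex) (auto simp: idx mult.commute inj_on_def inj_def)
    finally show ?thesis .
  qed
  moreover have "germ C K (\<Otimes>\<^bsub>L\<^esub>U\<in>set_mset m. U [^]\<^bsub>L\<^esub> count m U)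
      (\<lambda>i. \<Otimes>\<^bsub>K\<^esub>U\<in>set_mset m. \<phi> (idx U) i [^]\<^bsub>K\<^esub> count m U)"
  proof (intro germ_finprod germ_power computable_fields)
    fix U
    assume "U \<in> set_mset m"
    then obtain n where "U = \<Phi> n"
      using assms by blast
    then show "germ C K U (\<phi> (idx U))"
      by (simp add: idx germ_\<Phi>)
  qed simp
  ultimately show ?thesis
    by simp
qed

text \<open>Once \<open>i\<close> exceeds all multiplicities, the exponents are genuine base
  \<open>i\<close> expansions: distinct monomials have distinct exponents, all below
  \<open>i ^ N\<close>.\<close>

lemma eventually_exponents:
  assumes "finite M" and M: "\<And>m. m \<in> M \<Longrightarrow> set_mset m \<subseteq> \<Phi> ` {..<N}"
  shows "\<forall>\<^sub>F i in cofinite_in C. inj_on (\<lambda>m. \<Sum>n<N. count m (\<Phi> n) * i ^ n) M \<and>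
           (\<forall>m\<in>M. (\<Sum>n<N. count m (\<Phi> n) * i ^ n) < element_degree K k (\<alpha> i))"
  \<comment> \<open>The summand \<open>N\<close> ensures \<open>i ^ N \<le> i ^ i\<close>; the total
    size of the monomials, plus one, makes every multiplicity a digit less than
    \<open>i\<close>.\<close>
  using eventually_cofinite_in_ge[of "Suc (N + (\<Sum>m\<in>M. size m))" C]
proof eventually_elim
  case (elim i)
  have digit: "count m U < i" if "m \<in> M" for m U
  proof -
    have "count m U \<le> size m"
      by (rule count_le_size)
    also have "\<dots> \<le> (\<Sum>m\<in>M. size m)"
      using \<open>finite M\<close> that by (intro member_le_sum) auto
    finally show ?thesis
      using elim by simp
  qed
  have "inj_on (\<lambda>m. \<Sum>n<N. count m (\<Phi> n) * i ^ n) M"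
  proof (rule inj_onI, rule multiset_eqI)
    fix m m' U
    assume mm': "m \<in> M" "m' \<in> M"
      and eq: "(\<Sum>n<N. count m (\<Phi> n) * i ^ n) = (\<Sum>n<N. count m' (\<Phi> n) * i ^ n)"
    show "count m U = count m' U"
    proof (cases "U \<in> \<Phi> ` {..<N}")
      case True
      then show ?thesis
        using digits_unique[OF eq] digit mm' by auto
    next
      case False
      then show ?thesis
        using M[OF mm'(1)] M[OF mm'(2)] by (metis not_in_iff subsetD)
    qed
  qed
  moreover have "(\<Sum>n<N. count m (\<Phi> n) * i ^ n) < element_degree K k (\<alpha> i)" if "m \<in> M" for m
  proof -
    have "(\<Sum>n<N. count m (\<Phi> n) * i ^ n) < i ^ N"
      using digit[OF that] by (rule digits_less)
    also have "\<dots> \<le> i ^ i"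
      using elim by (intro power_increasing) auto
    finally show ?thesis
      using degree_\<alpha>[of i] by simp
  qed
  ultimately show ?case
    by blast
qed

text \<open>The finite support of a relation involves only variables \<open>\<Phi> n\<close> with
  \<open>n < N\<close> for some \<open>N\<close>. Its monomials then have eventually distinct
  exponents below the degree, so uniqueness forces all coefficients to vanish.\<close>

lemma algebraically_independent_\<Phi>: "algebraically_independent L kL (range \<Phi>)"
  unfolding algebraically_independent_def
proof (intro conjI ballI impI)
  show "range \<Phi> \<subseteq> carrier L"
    using germ_\<Phi> germ_carrier by blast
next
  fix P
  assume P: "P \<in> L.indexed_pset (range \<Phi>) kL" and zero: "eval_at_indices L P = \<zero>\<^bsub>L\<^esub>"
  define M where "M = {m. P m \<noteq> \<zero>\<^bsub>L\<^esub>}"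
  define Y where "Y m = (\<Otimes>\<^bsub>L\<^esub>U\<in>set_mset m. U [^]\<^bsub>L\<^esub> count m U)" for m :: "(nat \<rightharpoonup> nat) set multiset"
  have M: "finite M" "\<And>m. m \<in> M \<Longrightarrow> set_mset m \<subseteq> range \<Phi>"
    using L.indexed_pset_support[OF P] by (auto simp: M_def)
  obtain J where J: "finite J" "(\<Union>m\<in>M. set_mset m) = \<Phi> ` J"
    using finite_subset_image[of "\<Union>m\<in>M. set_mset m" \<Phi> UNIV] M by (auto simp: UN_subset_iff)
  obtain N where "J \<subseteq> {..<N}"
    using finite_nat_bounded[OF J(1)] by blast
  then have N: "set_mset m \<subseteq> \<Phi> ` {..<N}" if "m \<in> M" for m
    using J(2) that by blast
  have coeff: "P m \<in> S" for m
    by (rule L.indexed_pset_coeff[OF P kL_subset_S zero_in_S add_in_S])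
  have Y: "Y m \<in> carrier L" if "m \<in> M" for m
    using germ_carrier[OF germ_monomial[OF N[OF that]]] by (simp add: Y_def)
  \<comment> \<open>Zero is written as a combination of the same monomials so that the coefficients
    can be compared.\<close>
  have sum: "(\<Oplus>\<^bsub>L\<^esub>m\<in>M. P m \<otimes>\<^bsub>L\<^esub> Y m) = (\<Oplus>\<^bsub>L\<^esub>m\<in>M. \<zero>\<^bsub>L\<^esub> \<otimes>\<^bsub>L\<^esub> Y m)"
  proof -
    have "(\<Oplus>\<^bsub>L\<^esub>m\<in>M. P m \<otimes>\<^bsub>L\<^esub> Y m) = \<zero>\<^bsub>L\<^esub>"
      using zero unfolding eval_at_indices_def M_def Y_def .
    also have "\<dots> = (\<Oplus>\<^bsub>L\<^esub>m\<in>M. \<zero>\<^bsub>L\<^esub> \<otimes>\<^bsub>L\<^esub> Y m)"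
      using Y by (intro L.add.finprod_one_eqI[symmetric]) auto
    finally show ?thesis .
  qed
  have "P m = \<zero>\<^bsub>L\<^esub>" if "m \<in> M" for m
  proof (rule combination_unique[OF M(1) coeff zero_in_S _ _ sum that])
    show "germ C K (Y m) (\<lambda>i. \<alpha> i [^]\<^bsub>K\<^esub> (\<Sum>n<N. count m (\<Phi> n) * i ^ n))" if "m \<in> M" for m
      unfolding Y_def by (rule germ_monomial[OF N[OF that]])
  qed (rule eventually_exponents[OF M(1) N])
  then have "P m = \<zero>\<^bsub>L\<^esub>" for m
    by (cases "m \<in> M") (auto simp: M_def)
  then show "P = L.indexed_const \<zero>\<^bsub>L\<^esub>"
    by (auto simp: L.indexed_zero_def)
qed

text \<open>As \<open>i ^ 0 = 1\<close>, the components of \<open>\<Phi> 0\<close> are the elements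
  \<open>\<alpha> i\<close>. Each fixed range of exponents is eventually below their degrees, so
  \<open>combination_unique\<close> applies with constant exponents.\<close>

lemma transcendental_\<Phi>: "(L.transcendental over kL) (\<Phi> 0)"
proof (rule L.transcendental_overI[OF _ kL_subset_S zero_in_S S_subset])
  show "\<Phi> 0 \<in> carrier L"
    by (rule germ_carrier[OF germ_\<Phi>])
next
  fix n c c' j
  assume c: "\<And>j. j < n \<Longrightarrow> c j \<in> S" "\<And>j. j < n \<Longrightarrow> c' j \<in> S" and "j < (n::nat)"
    and sum: "(\<Oplus>\<^bsub>L\<^esub>j\<in>{..<n}. c j \<otimes>\<^bsub>L\<^esub> \<Phi> 0 [^]\<^bsub>L\<^esub> j) = (\<Oplus>\<^bsub>L\<^esub>j\<in>{..<n}. c' j \<otimes>\<^bsub>L\<^esub> \<Phi> 0 [^]\<^bsub>L\<^esub> j)"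
  have germ: "germ C K (\<Phi> 0 [^]\<^bsub>L\<^esub> j) (\<lambda>i. \<alpha> i [^]\<^bsub>K\<^esub> j)" for j :: nat
    using germ_power[OF computable_fields(1) germ_\<Phi>[of 0], of j] by (simp add: \<phi>_def \<alpha>_carrier)
  have "\<forall>\<^sub>F i in cofinite_in C. inj_on (\<lambda>j. j) {..<n} \<and>
      (\<forall>j\<in>{..<n}. j < element_degree K k (\<alpha> i))"
    using eventually_less_degree[of n] by eventually_elim auto
  then show "c j = c' j"
    using combination_unique[of "{..<n}" c c' "\<lambda>j. \<Phi> 0 [^]\<^bsub>L\<^esub> j" "\<lambda>j i. j" j] c germ sum \<open>j < n\<close>
    by simp
qed

end

theorem theorem4p8:
  fixes K F :: "nat ring" and \<Psi> :: "nat \<Rightarrow> nat" and C :: "nat set"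
  assumes "computable_field_extension K F \<Psi>"
    and "algebraic_extension K (\<Psi> ` carrier F)"
    and "computable_on (carrier K) (element_degree K (\<Psi> ` carrier F))"
    and "cohesive C"
    and "\<not> bdd_above {element_degree K (\<Psi> ` carrier F) \<alpha> | \<alpha>. \<alpha> \<in> carrier K}"
  shows "transcendental_extension (cohesive_power C K)
           (cohesive_power_embedding C K \<Psi> ` carrier (cohesive_power C F)) \<and>
         infinite_transcendence_degree (cohesive_power C K)
           (cohesive_power_embedding C K \<Psi> ` carrier (cohesive_power C F))"
proof -
  interpret unbounded_degree_extension K F \<Psi> C
    using assms by unfold_locales (auto simp: cohesive_def)
  have "infinite (range \<Phi>)"
    using \<Phi>_inj by (rule range_inj_infinite)
  then have "infinite_transcendence_degree L kL"
    using infinite_transcendence_degreeI[OF L.ring_axioms algebraically_independent_\<Phi>] by blast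
  moreover have "transcendental_extension L kL"
    using transcendental_\<Phi> germ_carrier[OF germ_\<Phi>] unfolding algebraic_extension_def over_def
    by blast
  ultimately show ?thesis
    by blast
qed

end
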